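(* Let $0<\varepsilon\le1$, $f\in L_2(\Omega)$ and $\lambda\ge3$. Then there is a unique $(u,v)\in V$ such that $$\mathcal{B}\bigl((u,v),(u_*,v_* )\bigr)=\mathcal{F}\bigl((u_*,v_* )\bigr)\qquad\forall\,(u_*,v_* )\in V.$$
   Context: $\Omega=(0,1)$; $\langle\cdot,\cdot\rangle$ is the $L_2(\Omega)$ inner product. $V:=H_0^2(\Omega)\times H^2(\Omega)$, where $H^2_0(\Omega)$ is the space of $w\in H^2(\Omega)$ with $w=w'=0$ at $0$ and $1$. The bilinear form $\mathcal{B}:V\times V\to\mathbb{R}$ and linear functional $\mathcal{F}:V\to\mathbb{R}$ are $$\mathcal{B}\bigl((u,v),(u_*,v_* )\bigr):=\lambda\langle v-\varepsilon^{3/2}u'',v_*-\varepsilon^{3/2}u_*''\rangle+\langle\varepsilon^{5/2}v''+4u,\varepsilon^{3/2}v_*''+4u_*\rangle,\qquad \mathcal{F}\bigl((u_*,v_* )\bigr):=\langle f,\varepsilon^{3/2}v_*''+4u_*\rangle .$$ *)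

theory Defs
  imports "HOL-Analysis.Analysis"
begin

text \<open>Elements of Lebesgue and Sobolev spaces are represented by functions on the real line of
  which only the values on \<open>\<Omega>\<close> matter; as usual, two of them denote the same element iff they
  agree almost everywhere on \<open>\<Omega>\<close>.\<close>

definition \<Omega> :: "real set"
  where "\<Omega> = {0<..<1}"

abbreviation leb\<Omega> :: "real measure"
  where "leb\<Omega> \<equiv> lebesgue_on \<Omega>"

definition L2 :: "(real \<Rightarrow> real) set"
  where "L2 = {w \<in> borel_measurable leb\<Omega>. integrable leb\<Omega> (\<lambda>x. (w x)\<^sup>2)}"

definition ip :: "(real \<Rightarrow> real) \<Rightarrow> (real \<Rightarrow> real) \<Rightarrow> real"
  where "ip w z = (LINT x|leb\<Omega>. w x * z x)"

definition ae_eq :: "(real \<Rightarrow> real) \<Rightarrow> (real \<Rightarrow> real) \<Rightarrow> bool"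
  where "ae_eq w z \<longleftrightarrow> (AE x in leb\<Omega>. w x = z x)"

text \<open>Smooth functions with compact support in \<open>\<Omega>\<close>. The support is closed by construction, and
  bounded because \<open>\<Omega>\<close> is.\<close>

definition test_functions :: "(real \<Rightarrow> real) set"
  where "test_functions =
    {\<phi>. (\<forall>k x. (deriv ^^ k) \<phi> differentiable (at x)) \<and> closure {x. \<phi> x \<noteq> 0} \<subseteq> \<Omega>}"

definition has_weak_deriv :: "nat \<Rightarrow> (real \<Rightarrow> real) \<Rightarrow> (real \<Rightarrow> real) \<Rightarrow> bool"
  where "has_weak_deriv k w g \<longleftrightarrow>
    (\<forall>\<phi>\<in>test_functions. ip w ((deriv ^^ k) \<phi>) = (-1) ^ k * ip g \<phi>)"

definition sobolev :: "nat \<Rightarrow> (real \<Rightarrow> real) set"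
  where "sobolev m = {w \<in> L2. \<forall>k\<le>m. \<exists>g\<in>L2. has_weak_deriv k w g}"

text \<open>Weak derivatives are determined only up to null sets, hence the choice. The forms below
  use the chosen function only under an integral.\<close>

definition weak_deriv :: "nat \<Rightarrow> (real \<Rightarrow> real) \<Rightarrow> real \<Rightarrow> real"
  where "weak_deriv k w = (SOME g. g \<in> L2 \<and> has_weak_deriv k w g)"

text \<open>The boundary conditions concern the representative that is continuously differentiable up
  to the boundary, which every element of \<open>sobolev 2\<close> has.\<close>

definition H2_0 :: "(real \<Rightarrow> real) set"
  where "H2_0 = {w \<in> sobolev 2. \<exists>W W'.
    ae_eq w W \<and>
    (\<forall>x\<in>{0..1}. (W has_real_derivative W' x) (at x within {0..1})) \<and>
    continuous_on {0..1} W' \<and>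
    W 0 = 0 \<and> W 1 = 0 \<and> W' 0 = 0 \<and> W' 1 = 0}"

definition V :: "((real \<Rightarrow> real) \<times> (real \<Rightarrow> real)) set"
  where "V = H2_0 \<times> sobolev 2"

definition bform :: "real \<Rightarrow> real \<Rightarrow> (real \<Rightarrow> real) \<times> (real \<Rightarrow> real) \<Rightarrow>
    (real \<Rightarrow> real) \<times> (real \<Rightarrow> real) \<Rightarrow> real"
  where "bform \<epsilon> lam = (\<lambda>(u, v) (us, vs).
    lam * ip (\<lambda>x. v x - \<epsilon> powr (3/2) * weak_deriv 2 u x)
             (\<lambda>x. vs x - \<epsilon> powr (3/2) * weak_deriv 2 us x)
    + ip (\<lambda>x. \<epsilon> powr (5/2) * weak_deriv 2 v x + 4 * u x)
         (\<lambda>x. \<epsilon> powr (3/2) * weak_deriv 2 vs x + 4 * us x))"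

definition rhs :: "real \<Rightarrow> (real \<Rightarrow> real) \<Rightarrow> (real \<Rightarrow> real) \<times> (real \<Rightarrow> real) \<Rightarrow> real"
  where "rhs \<epsilon> f = (\<lambda>(us, vs). ip f (\<lambda>x. \<epsilon> powr (3/2) * weak_deriv 2 vs x + 4 * us x))"

end

theory Submission
  imports Defs "HOL-Real_Asymp.Real_Asymp"
begin

text \<open>Write \<open>a = \<epsilon> powr (3/2)\<close>, so that \<open>\<epsilon> powr (5/2) = \<epsilon> * a\<close> and \<open>\<epsilon> * a\<^sup>2 = \<epsilon>\<^sup>4\<close>. The form tests the residuals of the
  system \<open>v = a u''\<close>, \<open>\<epsilon> a v'' + 4 u = f\<close>, which is the clamped fourth-order problem
  \<open>\<epsilon>\<^sup>4 u'''' + 4 u = f\<close> with the auxiliary unknown \<open>v\<close>.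

  Existence. If \<open>u\<close> solves the clamped problem weakly and \<open>v = a u''\<close>, then the first residual vanishes and the second
  operator yields exactly \<open>f\<close>, so \<open>bform \<epsilon> lam (u, v) = rhs \<epsilon> f\<close>. The clamped problem has
  constant coefficients and is solved explicitly: for \<open>\<kappa> = 1/\<epsilon>\<close>, the number 4 is what makes
  \<open>\<alpha> = \<kappa> (1 + \<i>)\<close> a characteristic root, and the real fourth-order equation becomes one complex second-order equation
  \<open>y'' = \<alpha>\<^sup>2 (y + G)\<close>. The clamped boundary conditions reduce to a two by two linear system whose determinant is
  \<open>(sinh\<^sup>2 \<kappa> - sin\<^sup>2 \<kappa>) / 2 > 0\<close> (\<open>clamped_ode\<close>). Since \<open>f\<close> is only square integrable, the equation is solved for the
  continuous datum obtained by integrating \<open>f\<close> twice, and the two derivatives are restored in the weak sense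
  (\<open>solution_exists\<close>).

  Uniqueness. The form is positive definite: with \<open>r = v - a u''\<close> it dominates \<open>\<parallel>r\<parallel>\<^sup>2 + 16 \<parallel>u\<parallel>\<^sup>2\<close> (\<open>bform_coercive\<close>).
  The only term of unclear sign is the cross term \<open>\<langle>u, v''\<rangle>\<close>, and Green's formula \<open>\<langle>u, v''\<rangle> = \<langle>u'', v\<rangle>\<close> (\<open>green_H2_0\<close>)
  turns it into \<open>a \<parallel>u''\<parallel>\<^sup>2 + \<langle>u'', r\<rangle>\<close>. Completing the square costs at most \<open>(1 + \<epsilon>) \<parallel>r\<parallel>\<^sup>2 \<le> 2 \<parallel>r\<parallel>\<^sup>2\<close>, which is where
  \<open>lam \<ge> 3\<close> comes from. The difference of two solutions therefore vanishes.

  Both halves need to compare weak derivatives, defined by testing, with classical ones. The bridge consists of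
  bump functions and the fundamental lemma of the calculus of variations (\<open>fundamental_lemma\<close>), integration by parts for
  absolutely continuous functions, obtained from Fubini's theorem (\<open>integration_by_parts_prim\<close>), and the lemma of du
  Bois-Reymond, which gives every function with a weak second derivative \<open>g\<close> the form of an affine function plus the
  double primitive of \<open>g\<close> (\<open>has_weak_deriv_2_repr\<close>).\<close>

section \<open>Square integrable functions on the unit interval\<close>

lemma sets_Omega [simp, measurable]: "\<Omega> \<in> sets lebesgue"
  by (simp add: \<Omega>_def)

lemma finite_measure_leb: "finite_measure leb\<Omega>"
  by (rule finite_measureI) (simp add: \<Omega>_def emeasure_restrict_space)

lemma AE_leb_of_AE_lborel:
  assumes "AE x in lborel. P x" shows "AE x in leb\<Omega>. P x"
proof -
  have "AE x in lebesgue. P x" using assms by (rule AE_completion)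
  then have "AE x in lebesgue. x \<in> \<Omega> \<longrightarrow> P x" by (rule eventually_mono) simp
  then show ?thesis by (simp add: AE_restrict_space_iff)
qed

lemma L2D: "w \<in> L2 \<Longrightarrow> w \<in> borel_measurable leb\<Omega>" "w \<in> L2 \<Longrightarrow> integrable leb\<Omega> (\<lambda>x. (w x)\<^sup>2)"
  by (auto simp: L2_def)

lemma ip_integrable:
  assumes "w \<in> L2" "z \<in> L2"
  shows "integrable leb\<Omega> (\<lambda>x. w x * z x)"
proof (rule Bochner_Integration.integrable_bound)
  show "integrable leb\<Omega> (\<lambda>x. (w x)\<^sup>2 + (z x)\<^sup>2)"
    using assms by (intro Bochner_Integration.integrable_add L2D)
  have "\<bar>a * b\<bar> \<le> a\<^sup>2 + b\<^sup>2" for a b :: real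
    using sum_squares_bound[of a b] sum_squares_bound[of a "-b"] by (auto simp: abs_if)
  then show "AE x in leb\<Omega>. norm (w x * z x) \<le> norm ((w x)\<^sup>2 + (z x)\<^sup>2)"
    by simp
qed (use assms[THEN L2D(1)] in measurable)

lemma L2_scale: "w \<in> L2 \<Longrightarrow> (\<lambda>x. c * w x) \<in> L2"
  by (auto simp: L2_def power_mult_distrib)

lemma L2_add:
  assumes "w \<in> L2" "z \<in> L2" shows "(\<lambda>x. w x + z x) \<in> L2"
proof -
  have "integrable leb\<Omega> (\<lambda>x. (w x)\<^sup>2 + (z x)\<^sup>2 + 2 * (w x * z x))"
    using assms by (intro Bochner_Integration.integrable_add L2D integrable_mult_right ip_integrable)
  also have "(\<lambda>x. (w x)\<^sup>2 + (z x)\<^sup>2 + 2 * (w x * z x)) = (\<lambda>x. (w x + z x)\<^sup>2)"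
    by (simp add: power2_eq_square algebra_simps)
  finally show ?thesis
    using assms by (auto simp: L2_def)
qed

lemma L2_diff: "w \<in> L2 \<Longrightarrow> z \<in> L2 \<Longrightarrow> (\<lambda>x. w x - z x) \<in> L2"
  using L2_add[of w "\<lambda>x. (-1) * z x"] L2_scale[of z "-1"] by simp

lemma L2_continuous:
  assumes "continuous_on {0..1} w" shows "w \<in> L2"
proof -
  have "integrable leb\<Omega> g" if "continuous_on {0..1} g" for g :: "real \<Rightarrow> real"
  proof -
    have "g absolutely_integrable_on {0..1}"
      using that by (rule absolutely_integrable_continuous_real)
    then have "g absolutely_integrable_on \<Omega>"
      by (rule set_integrable_subset) (auto simp: \<Omega>_def)
    then show ?thesis
      by (rule absolutely_integrable_imp_integrable) simp
  qed
  from this[OF assms] this[of "\<lambda>x. (w x)\<^sup>2"] show ?thesis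
    using assms by (auto simp: L2_def intro!: continuous_intros)
qed

lemma L2_const: "(\<lambda>x. c) \<in> L2"
  by (intro L2_continuous continuous_intros)

lemma L2_integrable: "w \<in> L2 \<Longrightarrow> integrable leb\<Omega> w"
  using ip_integrable[of w "\<lambda>x. 1"] L2_const[of 1] by simp

lemma integrable_indicator_mult:
  fixes g :: "real \<Rightarrow> real"
  assumes "integrable leb\<Omega> g" "B \<in> sets lebesgue"
  shows "integrable leb\<Omega> (\<lambda>x. indicator B x * g x)"
proof -
  have "B \<inter> \<Omega> \<in> sets leb\<Omega>" using assms(2) by (auto simp: sets_restrict_space)
  from integrable_mult_indicator[OF this assms(1)]
  show ?thesis
    by (rule Bochner_Integration.integrable_cong[THEN iffD1, rotated 2])
       (use assms(1) in \<open>auto simp: indicator_def\<close>)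
qed

lemma ip_commute: "ip w z = ip z w"
  by (simp add: ip_def mult.commute)

lemma ip_zero [simp]: "ip (\<lambda>x. 0) z = 0"
  by (simp add: ip_def)

lemma ip_add:
  assumes "w \<in> L2" "w' \<in> L2" "z \<in> L2"
  shows "ip (\<lambda>x. w x + w' x) z = ip w z + ip w' z" "ip z (\<lambda>x. w x + w' x) = ip z w + ip z w'"
  using assms by (simp_all add: ip_def algebra_simps ip_integrable)

lemma ip_diff:
  assumes "w \<in> L2" "w' \<in> L2" "z \<in> L2"
  shows "ip (\<lambda>x. w x - w' x) z = ip w z - ip w' z" "ip z (\<lambda>x. w x - w' x) = ip z w - ip z w'"
  using assms by (simp_all add: ip_def algebra_simps ip_integrable)

lemma ip_scale: "ip (\<lambda>x. c * w x) z = c * ip w z" "ip w (\<lambda>x. c * z x) = c * ip w z"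
  by (simp_all add: ip_def algebra_simps flip: integral_mult_right_zero)

lemma ae_eqI: "(\<And>x. x \<in> \<Omega> \<Longrightarrow> w x = z x) \<Longrightarrow> ae_eq w z"
  by (auto simp: ae_eq_def intro!: AE_I2)

lemma ae_eq_sym: "ae_eq w z \<Longrightarrow> ae_eq z w"
  by (auto simp: ae_eq_def)

lemma ip_cong:
  assumes "ae_eq w w'" "w \<in> L2" "w' \<in> L2" "z \<in> L2"
  shows "ip w z = ip w' z"
  unfolding ip_def
proof (rule integral_cong_AE)
  show "AE x in leb\<Omega>. w x * z x = w' x * z x"
    using assms(1) unfolding ae_eq_def by eventually_elim simp
qed (use assms(2-4)[THEN L2D(1)] in measurable)

lemma ip_self_nonneg: "0 \<le> ip w w"
  by (auto simp: ip_def intro!: integral_nonneg_AE)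

lemma ip_self_zero:
  assumes "w \<in> L2" "ip w w = 0" shows "ae_eq w (\<lambda>x. 0)"
proof -
  have "AE x in leb\<Omega>. w x * w x = 0"
    using assms integral_nonneg_eq_0_iff_AE[of leb\<Omega> "\<lambda>x. w x * w x"]
    by (simp add: ip_def ip_integrable)
  then show ?thesis by (simp add: ae_eq_def)
qed

section \<open>Test functions\<close>

definition smooth :: "(real \<Rightarrow> real) \<Rightarrow> bool"
  where "smooth f \<longleftrightarrow> (\<forall>k x. (deriv ^^ k) f differentiable (at x))"

lemma test_functions_iff: "\<phi> \<in> test_functions \<longleftrightarrow> smooth \<phi> \<and> closure {x. \<phi> x \<noteq> 0} \<subseteq> \<Omega>"
  by (simp add: test_functions_def smooth_def)

lemma smooth_DERIV: "smooth f \<Longrightarrow> (f has_real_derivative deriv f x) (at x)"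
  unfolding smooth_def by (metis DERIV_deriv_iff_real_differentiable funpow_0)

lemma smooth_iff_deriv: "smooth f \<longleftrightarrow> (\<forall>x. f differentiable (at x)) \<and> smooth (deriv f)"
proof
  assume "smooth f"
  then show "(\<forall>x. f differentiable (at x)) \<and> smooth (deriv f)"
    unfolding smooth_def by (metis funpow_0 funpow_Suc_right comp_apply)
next
  assume *: "(\<forall>x. f differentiable (at x)) \<and> smooth (deriv f)"
  have "(deriv ^^ k) f differentiable (at x)" for k x
    using * by (cases k) (auto simp: smooth_def funpow_Suc_right simp del: funpow.simps)
  then show "smooth f" by (simp add: smooth_def)
qed

text \<open>A family of functions closed under differentiation consists of smooth functions. This avoids
  any formula for higher derivatives: it suffices to exhibit the family.\<close>

lemma smooth_coinduct:
  assumes "f \<in> S" and step: "\<And>g. g \<in> S \<Longrightarrow> \<exists>g'\<in>S. \<forall>x. (g has_real_derivative g' x) (at x)"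
  shows "smooth f"
proof -
  have *: "deriv g \<in> S" "g differentiable (at x)" if g: "g \<in> S" for g x
  proof -
    obtain g' where g': "g' \<in> S" "\<forall>x. (g has_real_derivative g' x) (at x)"
      using step[OF g] by auto
    then have "deriv g = g'" by (auto intro: DERIV_imp_deriv)
    with g' show "deriv g \<in> S" "g differentiable (at x)"
      by (auto simp: real_differentiable_def)
  qed
  have "(deriv ^^ k) f \<in> S" for k
    by (induction k) (use assms * in auto)
  then show ?thesis using * by (auto simp: smooth_def)
qed

lemma smooth_lincomb:
  assumes "smooth f" "smooth g" shows "smooth (\<lambda>x. a * f x + b * g x)"
proof (rule smooth_coinduct)
  show "(\<lambda>x. a * f x + b * g x) \<in> {\<lambda>x. a * f x + b * g x | f g. smooth f \<and> smooth g}"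
    using assms by auto
next
  fix h assume "h \<in> {\<lambda>x. a * f x + b * g x | f g. smooth f \<and> smooth g}"
  then obtain f g where h: "h = (\<lambda>x. a * f x + b * g x)" and fg: "smooth f" "smooth g" by blast
  have "\<forall>x. (h has_real_derivative a * deriv f x + b * deriv g x) (at x)"
    unfolding h using fg by (auto intro!: derivative_eq_intros smooth_DERIV)
  moreover have "smooth (deriv f)" "smooth (deriv g)"
    using fg smooth_iff_deriv by blast+
  ultimately show "\<exists>g'\<in>{\<lambda>x. a * f x + b * g x | f g. smooth f \<and> smooth g}.
      \<forall>x. (h has_real_derivative g' x) (at x)"
    by (intro bexI[of _ "\<lambda>x. a * deriv f x + b * deriv g x"]) auto
qed

text \<open>The building block of bump functions, \<open>exp (-1/y)\<close> extended by zero, with a power of \<open>y\<close> in the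
  denominator because such powers appear on differentiation.\<close>

definition flat :: "nat \<Rightarrow> real \<Rightarrow> real"
  where "flat m y = (if y > 0 then exp (- 1 / y) / y ^ m else 0)"

text \<open>One term of the exponential series beats the power in the denominator. Quadratic decay at 0
  is what makes the derivative at 0 exist and vanish.\<close>

lemma flat_le_quadratic: "\<bar>flat m y\<bar> \<le> fact (m + 2) * y\<^sup>2"
proof (cases "y > 0")
  case True
  define F :: real where "F = fact (m + 2)"
  have F: "F > 0" by (simp add: F_def)
  have "(\<Sum>n\<in>{m + 2}. (1 / y) ^ n /\<^sub>R fact n) \<le> (\<Sum>n. (1 / y) ^ n /\<^sub>R fact n)"
    using True by (intro sum_le_suminf summable_exp_generic) auto
  then have "(1 / y) ^ (m + 2) / F \<le> exp (1 / y)"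
    by (simp add: exp_def divide_inverse mult.commute F_def)
  then have "1 \<le> exp (1 / y) * F * y ^ (m + 2)"
    using True F by (simp add: power_divide pos_divide_le_eq ac_simps del: power_add power_Suc)
  then have "exp (- (1 / y)) \<le> F * y ^ (m + 2)"
    by (simp add: exp_minus field_simps del: power_add power_Suc)
  then show ?thesis
    using True unfolding F_def[symmetric]
    by (simp add: flat_def pos_divide_le_eq power_add power2_eq_square ac_simps)
qed (simp add: flat_def)

lemma DERIV_flat: "(flat m has_real_derivative flat (m + 2) y - m * flat (m + 1) y) (at y)"
proof -
  consider "y < 0" | "y > 0" | "y = 0" by linarith
  then show ?thesis
  proof cases
    case 1
    have "((\<lambda>x. 0) has_real_derivative 0) (at y)" by simp
    then have "(flat m has_real_derivative 0) (at y)"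
      by (rule has_field_derivative_transform_within_open[of _ _ _ "{..<0}"])
         (use 1 in \<open>auto simp: flat_def\<close>)
    with 1 show ?thesis by (simp add: flat_def)
  next
    case 2
    have "((\<lambda>x. exp (- 1 / x) / x ^ m) has_real_derivative flat (m + 2) y - m * flat (m + 1) y) (at y)"
    proof (cases m)
      case 0
      with 2 show ?thesis
        by (auto intro!: derivative_eq_intros simp: flat_def field_simps power2_eq_square)
    next
      case (Suc k)
      with 2 show ?thesis
        by (auto intro!: derivative_eq_intros simp: flat_def field_simps power2_eq_square)
          (cases k; simp)
    qed
    then show ?thesis
      by (rule has_field_derivative_transform_within_open[of _ _ _ "{0<..}"])
         (use 2 in \<open>auto simp: flat_def\<close>)
  next
    case 3
    obtain C where C: "\<bar>flat m h\<bar> \<le> C * h\<^sup>2" for h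
      using flat_le_quadratic by metis
    have "((\<lambda>h. flat m h / h) \<longlongrightarrow> 0) (at 0)"
    proof (rule Lim_null_comparison)
      have "norm (flat m h / h) \<le> C * \<bar>h\<bar>" for h
        using C[of h] by (cases "h = 0")
          (auto simp: pos_divide_le_eq power2_eq_square mult.assoc simp flip: abs_mult)
      then show "\<forall>\<^sub>F h in at 0. norm (flat m h / h) \<le> C * \<bar>h\<bar>" by simp
      show "((\<lambda>h::real. C * \<bar>h\<bar>) \<longlongrightarrow> 0) (at 0)"
        by (auto intro!: tendsto_eq_intros)
    qed
    with 3 show ?thesis by (simp add: DERIV_def flat_def)
  qed
qed

text \<open>Since \<open>flat m y = y\<^sup>2 * flat (m + 2) y\<close> and \<open>flat (m + 1) y = y * flat (m + 2) y\<close>, the derivative of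
  \<open>N * flat m (q)\<close>, for polynomials \<open>N\<close> and \<open>q\<close>, is again a polynomial times a single \<open>flat (m + 2) (q)\<close>.\<close>

lemma smooth_flat_poly: "smooth (\<lambda>x. flat 0 (poly q x))"
proof (rule smooth_coinduct)
  show "(\<lambda>x. flat 0 (poly q x)) \<in> {\<lambda>x. poly N x * flat m (poly q x) | N m. True}"
    by (intro CollectI exI[of _ 1] exI[of _ 0]) simp
next
  fix g assume "g \<in> {\<lambda>x. poly N x * flat m (poly q x) | N m. True}"
  then obtain N m where g: "g = (\<lambda>x. poly N x * flat m (poly q x))" by blast
  define M where "M = pderiv N * q\<^sup>2 - of_nat m * N * q * pderiv q + N * pderiv q"
  have "(g has_real_derivative poly M x * flat (m + 2) (poly q x)) (at x)" for x
  proof -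
    have "flat m y = y\<^sup>2 * flat (m + 2) y" "flat (m + 1) y = y * flat (m + 2) y" for y
      by (auto simp: flat_def power2_eq_square)
    note [simp] = this[of "poly q x", unfolded One_nat_def add_Suc_right add_0_right]
    show ?thesis
      unfolding g M_def
      by (rule derivative_eq_intros DERIV_chain2[OF DERIV_flat] poly_DERIV refl)+
         (simp add: algebra_simps)
  qed
  then show "\<exists>g'\<in>{\<lambda>x. poly N x * flat m (poly q x) | N m. True}. \<forall>x. (g has_real_derivative g' x) (at x)"
    by (intro bexI[of _ "\<lambda>x. poly M x * flat (m + 2) (poly q x)"]) auto
qed

text \<open>The scaling by \<open>n\<close> drives the bump to the indicator of the interval, and the shift by 1 keeps the
  support of each bump a compact part of the open interval.\<close>

definition bump :: "real \<Rightarrow> real \<Rightarrow> nat \<Rightarrow> real \<Rightarrow> real"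
  where "bump a b n x = flat 0 (n * ((x - a) * (b - x)) - 1)"

lemma bump_test:
  assumes "0 \<le> a" "a \<le> b" "b \<le> 1"
  shows "bump a b n \<in> test_functions"
proof -
  define q where "q = smult (real n) ([:-a, 1:] * [:b, -1:]) - 1"
  have q: "poly q x = n * ((x - a) * (b - x)) - 1" for x
    by (simp add: q_def algebra_simps)
  have "closure {x. bump a b n x \<noteq> 0} \<subseteq> {x. 0 \<le> n * ((x - a) * (b - x)) - 1}"
    by (intro closure_minimal closed_Collect_le continuous_intros) (auto simp: bump_def flat_def)
  also have "\<dots> \<subseteq> \<Omega>"
  proof
    fix x assume "x \<in> {x. 0 \<le> n * ((x - a) * (b - x)) - 1}"
    then have "0 < n * ((x - a) * (b - x))" by simp
    then have "0 < (x - a) * (b - x)" by (simp add: zero_less_mult_iff)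
    then show "x \<in> \<Omega>" using assms by (auto simp: \<Omega>_def zero_less_mult_iff)
  qed
  finally show ?thesis
    using smooth_flat_poly[of q] by (simp add: test_functions_iff bump_def[abs_def] q)
qed

lemma bump_tendsto:
  assumes "a \<le> b"
  shows "(\<lambda>n. bump a b n x) \<longlonglongrightarrow> indicator {a<..<b} x"
proof (cases "x \<in> {a<..<b}")
  case True
  define c where "c = (x - a) * (b - x)"
  have c: "c > 0" using True by (simp add: c_def)
  have lim: "filterlim (\<lambda>n. real n * c - 1) at_top sequentially"
    using c by real_asymp
  have "(\<lambda>n. exp (- 1 / (real n * c - 1))) \<longlonglongrightarrow> exp 0"
    by (intro tendsto_intros real_tendsto_divide_at_top[OF tendsto_const lim])
  moreover have "\<forall>\<^sub>F n in sequentially. exp (- 1 / (real n * c - 1)) = bump a b n x"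
    using filterlim_at_top_dense[THEN iffD1, OF lim, rule_format, of 0]
    by eventually_elim (simp add: bump_def flat_def c_def)
  ultimately show ?thesis
    using True by (auto elim: Lim_transform_eventually)
next
  case False
  then have "(x - a) * (b - x) \<le> 0" using assms by (auto simp: mult_le_0_iff)
  then have "n * ((x - a) * (b - x)) \<le> 0" for n :: nat
    by (simp add: mult_nonneg_nonpos)
  then have "bump a b n x = 0" for n
    by (simp add: bump_def flat_def not_less add_increasing2 order_trans[of _ 0 1])
  with False show ?thesis by simp
qed

lemma bump_bounds: "\<bar>bump a b n x\<bar> \<le> 1"
  by (simp add: bump_def flat_def)

lemma test_continuous: "\<phi> \<in> test_functions \<Longrightarrow> continuous_on S \<phi>"
  by (auto simp: test_functions_iff intro!: DERIV_isCont continuous_at_imp_continuous_on dest!: smooth_DERIV)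

lemma test_L2: "\<phi> \<in> test_functions \<Longrightarrow> \<phi> \<in> L2"
  by (intro L2_continuous test_continuous)

lemma test_zero: "\<phi> \<in> test_functions \<Longrightarrow> x \<notin> \<Omega> \<Longrightarrow> \<phi> x = 0"
  using closure_subset[of "{x. \<phi> x \<noteq> 0}"] by (auto simp: test_functions_iff)

lemma test_DERIV: "\<phi> \<in> test_functions \<Longrightarrow> (\<phi> has_real_derivative deriv \<phi> x) (at x)"
  by (simp add: test_functions_iff smooth_DERIV)

text \<open>Outside the closed support the function vanishes on a neighbourhood, hence so does the
  derivative there.\<close>

lemma test_deriv:
  assumes "\<phi> \<in> test_functions" shows "deriv \<phi> \<in> test_functions"
proof -
  have "{x. deriv \<phi> x \<noteq> 0} \<subseteq> closure {x. \<phi> x \<noteq> 0}"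
  proof
    fix x assume x: "x \<in> {x. deriv \<phi> x \<noteq> 0}"
    show "x \<in> closure {x. \<phi> x \<noteq> 0}"
    proof (rule ccontr)
      assume n: "x \<notin> closure {x. \<phi> x \<noteq> 0}"
      have "((\<lambda>x. 0) has_real_derivative 0) (at x)" by simp
      then have "(\<phi> has_real_derivative 0) (at x)"
        by (rule has_field_derivative_transform_within_open[of _ _ _ "- closure {x. \<phi> x \<noteq> 0}"])
           (use n closure_subset[of "{x. \<phi> x \<noteq> 0}"] in auto)
      then show False using x by (auto dest: DERIV_imp_deriv)
    qed
  qed
  then have "closure {x. deriv \<phi> x \<noteq> 0} \<subseteq> closure {x. \<phi> x \<noteq> 0}"
    by (rule closure_minimal) simp
  moreover have "smooth (deriv \<phi>)"
    using assms by (simp add: test_functions_iff smooth_iff_deriv[of \<phi>])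
  ultimately show ?thesis
    using assms by (auto simp: test_functions_iff)
qed

lemma test_higher_deriv: "\<phi> \<in> test_functions \<Longrightarrow> (deriv ^^ k) \<phi> \<in> test_functions"
  by (induction k) (auto intro: test_deriv)

lemma test_lincomb:
  assumes "\<phi> \<in> test_functions" "\<psi> \<in> test_functions"
  shows "(\<lambda>x. a * \<phi> x + b * \<psi> x) \<in> test_functions"
proof -
  have "closure {x. a * \<phi> x + b * \<psi> x \<noteq> 0} \<subseteq> closure ({x. \<phi> x \<noteq> 0} \<union> {x. \<psi> x \<noteq> 0})"
    by (rule closure_mono) auto
  then show ?thesis
    using assms by (auto simp: test_functions_iff smooth_lincomb)
qed

section \<open>The fundamental lemma of the calculus of variations\<close>

text \<open>Bumps converge boundedly to the indicators of intervals, so \<open>g\<close> has integral zero over every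
  interval. Intervals generate the Borel sets, and the sets on which the integral vanishes form a Dynkin system. Lebesgue
  sets differ from Borel sets by null sets only.\<close>

lemma fundamental_lemma:
  assumes g: "integrable leb\<Omega> g" and zero: "\<And>\<phi>. \<phi> \<in> test_functions \<Longrightarrow> ip g \<phi> = 0"
  shows "ae_eq g (\<lambda>x. 0)"
proof -
  interpret finite_measure leb\<Omega> by (rule finite_measure_leb)
  have [measurable]: "g \<in> borel_measurable leb\<Omega>"
    using g by (rule borel_measurable_integrable)
  note ind = integrable_indicator_mult[OF g]
  have interval: "(LINT x|leb\<Omega>. indicator {a<..<b} x * g x) = 0" if ab: "0 \<le> a" "a \<le> b" "b \<le> 1" for a b
  proof -
    have "(\<lambda>n. LINT x|leb\<Omega>. bump a b n x * g x) \<longlonglongrightarrow> (LINT x|leb\<Omega>. indicator {a<..<b} x * g x)"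
    proof (rule integral_dominated_convergence[where w = "\<lambda>x. norm (g x)"])
      show "(\<lambda>x. bump a b n x * g x) \<in> borel_measurable leb\<Omega>" for n
        using L2D(1)[OF test_L2[OF bump_test[OF ab]]] by measurable
      show "AE x in leb\<Omega>. (\<lambda>n. bump a b n x * g x) \<longlonglongrightarrow> indicator {a<..<b} x * g x"
        using ab by (intro AE_I2 tendsto_intros bump_tendsto)
      show "AE x in leb\<Omega>. norm (bump a b n x * g x) \<le> norm (g x)" for n
        using bump_bounds[of a b n] by (simp add: abs_mult mult_left_le_one_le)
    qed (use g ind[of "{a<..<b}"] in \<open>auto intro!: borel_measurable_integrable\<close>)
    moreover have "(LINT x|leb\<Omega>. bump a b n x * g x) = 0" for n
      using zero[OF bump_test[OF ab, of n]] by (simp add: ip_def mult.commute)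
    ultimately show ?thesis by (simp add: LIMSEQ_const_iff)
  qed
  have box: "(LINT x|leb\<Omega>. indicator (box a b) x * g x) = 0" for a b
  proof (cases "max a 0 \<le> min b 1")
    case True
    have "(LINT x|leb\<Omega>. indicator (box a b) x * g x)
        = (LINT x|leb\<Omega>. indicator {max a 0<..<min b 1} x * g x)"
      by (rule Bochner_Integration.integral_cong) (auto simp: indicator_def \<Omega>_def)
    with True show ?thesis by (simp add: interval)
  next
    case False
    have "(LINT x|leb\<Omega>. indicator (box a b) x * g x) = (LINT x|leb\<Omega>. 0)"
      by (rule Bochner_Integration.integral_cong) (use False in \<open>auto simp: indicator_def \<Omega>_def\<close>)
    then show ?thesis by simp
  qed
  have borel: "(LINT x|leb\<Omega>. indicator B x * g x) = 0" if "B \<in> sets borel" for B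
  proof -
    let ?G = "range (\<lambda>(a::real, b). box a b)"
    have "box a b \<inter> box c d \<in> ?G" for a b c d :: real
      by (rule range_eqI[of _ _ "(max a c, min b d)"]) auto
    then have stable: "Int_stable ?G"
      unfolding Int_stable_def by (force simp del: box_real)
    have B: "B \<in> sigma_sets UNIV ?G"
      using that by (simp add: borel_eq_box)
    have leb: "A \<in> sets lebesgue" if "A \<in> sigma_sets UNIV ?G" for A
      using that by (simp add: borel_eq_box)
    from stable subset_UNIV[of ?G, folded Pow_UNIV] B show ?thesis
    proof (induction rule: sigma_sets_induct_disjoint)
      case (basic A)
      then show ?case using box by auto
    next
      case empty
      then show ?case by simp
    next
      case (compl A)
      have "(LINT x|leb\<Omega>. indicator (UNIV - A) x * g x)
          = (LINT x|leb\<Omega>. indicator {0<..<1} x * g x - indicator A x * g x)"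
        by (rule Bochner_Integration.integral_cong) (auto simp: indicator_def \<Omega>_def)
      also have "\<dots> = 0"
        using compl ind[OF leb, of A] ind[of "{0<..<1}"] interval[of 0 1] by simp
      finally show ?case .
    next
      case (union A)
      have Ai: "A i \<in> sets lebesgue" for i
        using leb union(2) by (auto simp del: box_real)
      have "(\<lambda>n. LINT x|leb\<Omega>. indicator (\<Union>i<n. A i) x * g x)
          \<longlonglongrightarrow> (LINT x|leb\<Omega>. indicator (\<Union>i. A i) x * g x)"
      proof (rule integral_dominated_convergence[where w = "\<lambda>x. norm (g x)"])
        show "AE x in leb\<Omega>. (\<lambda>n. indicator (\<Union>i<n. A i) x * g x) \<longlonglongrightarrow> indicator (\<Union>i. A i) x * g x"
          by (intro AE_I2 tendsto_intros LIMSEQ_indicator_UN)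
        show "AE x in leb\<Omega>. norm (indicator (\<Union>i<n. A i) x * g x) \<le> norm (g x)" for n
          by (simp add: indicator_def)
        show "(\<lambda>x. indicator (\<Union>i<n. A i) x * g x) \<in> borel_measurable leb\<Omega>" for n
          using ind[of "\<Union>i<n. A i"] Ai by (auto intro!: borel_measurable_integrable)
        show "(\<lambda>x. indicator (\<Union>i. A i) x * g x) \<in> borel_measurable leb\<Omega>"
          using ind[of "\<Union>i. A i"] Ai by (auto intro!: borel_measurable_integrable)
      qed (use g in auto)
      moreover have "(LINT x|leb\<Omega>. indicator (\<Union>i<n. A i) x * g x) = 0" for n
      proof (induction n)
        case (Suc n)
        have disj: "A n \<inter> (\<Union>i<n. A i) = {}"
          using disjoint_family_onD[OF union(1), of n] by fastforce
        have "indicator (\<Union>i<Suc n. A i) x * g x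
            = indicator (\<Union>i<n. A i) x * g x + indicator (A n) x * g x" for x
          using disj by (auto simp: indicator_def lessThan_Suc)
        then show ?case
          using Suc union(3) Ai ind[of "\<Union>i<n. A i"] ind[of "A n"] by simp
      qed simp
      ultimately show ?case by (simp add: LIMSEQ_const_iff)
    qed
  qed
  have "AE x in leb\<Omega>. g x = 0"
  proof (rule density_zero[OF g])
    fix A assume A: "A \<in> sets leb\<Omega>"
    then have "A \<in> sets lebesgue" by (auto simp: sets_restrict_space)
    then obtain S N N' where S: "A = S \<union> N" "N \<subseteq> N'" "N' \<in> null_sets lborel" "S \<in> sets borel"
      using sets_completionE by (metis sets_lborel)
    have AE: "AE x in leb\<Omega>. x \<notin> N'"
      using AE_not_in[OF S(3)] by (rule AE_leb_of_AE_lborel)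
    have "(LINT x|leb\<Omega>. indicator A x * g x) = (LINT x|leb\<Omega>. indicator S x * g x)"
    proof (rule integral_cong_AE)
      show "AE x in leb\<Omega>. indicator A x * g x = indicator S x * g x"
        using AE by eventually_elim (use S in \<open>auto simp: indicator_def\<close>)
    qed (use ind \<open>A \<in> sets lebesgue\<close> S(4) in \<open>auto intro!: borel_measurable_integrable\<close>)
    then show "set_lebesgue_integral leb\<Omega> A g = 0"
      using borel[OF S(4)] by (simp add: set_lebesgue_integral_def)
  qed
  then show ?thesis by (simp add: ae_eq_def)
qed

section \<open>Primitives and integration by parts\<close>

text \<open>Written with an indicator rather than as an integral over \<open>{0..x}\<close>, so that it is defined for
  all real \<open>x\<close>, being 0 to the left of \<open>\<Omega>\<close> and constant to the right of it, and so that Fubini's theorem applies directly.\<close>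

definition prim :: "(real \<Rightarrow> real) \<Rightarrow> real \<Rightarrow> real"
  where "prim g x = (LINT t|leb\<Omega>. indicator {..<x} t * g t)"

lemma prim_0: "prim g 0 = 0"
proof -
  have "prim g 0 = (LINT t|leb\<Omega>. 0)"
    unfolding prim_def by (rule Bochner_Integration.integral_cong) (auto simp: \<Omega>_def)
  then show ?thesis by simp
qed

lemma prim_1: "prim g 1 = (LINT t|leb\<Omega>. g t)"
  unfolding prim_def by (rule Bochner_Integration.integral_cong) (auto simp: \<Omega>_def)

lemma prim_eq_integral:
  assumes "g \<in> L2" "x \<in> {0..1}"
  shows "prim g x = integral {0..x} g"
proof -
  have "prim g x = integral \<Omega> (\<lambda>t. indicator {..<x} t * g t)"
    unfolding prim_def using assms
    by (intro lebesgue_integral_eq_integral integrable_indicator_mult L2_integrable) auto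
  also have "\<dots> = integral \<Omega> (\<lambda>t. if t \<in> {..<x} then g t else 0)"
    by (rule Henstock_Kurzweil_Integration.integral_cong) (simp add: indicator_def)
  also have "\<dots> = integral (\<Omega> \<inter> {..<x}) g"
    by (simp only: integral_restrict_Int Int_commute)
  also have "\<Omega> \<inter> {..<x} = {0<..<x}"
    using assms by (auto simp: \<Omega>_def)
  also have "integral {0<..<x} g = integral {0..x} g"
    using integral_open_interval[of 0 x g] by simp
  finally show ?thesis .
qed

lemma L2_integrable_on: "g \<in> L2 \<Longrightarrow> g integrable_on {0..1}"
  using integrable_on_lebesgue_on[OF L2_integrable, of g] integrable_on_open_interval[of g 0 1]
  by (simp add: \<Omega>_def)

lemma continuous_prim:
  assumes "g \<in> L2" shows "continuous_on {0..1} (prim g)"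
  using indefinite_integral_continuous_1[OF L2_integrable_on[OF assms]]
  by (rule continuous_on_eq) (simp add: prim_eq_integral assms)

lemma prim_L2: "g \<in> L2 \<Longrightarrow> prim g \<in> L2"
  by (rule L2_continuous[OF continuous_prim])

lemma DERIV_prim:
  assumes "continuous_on {0..1} g" "x \<in> {0..1}"
  shows "(prim g has_real_derivative g x) (at x within {0..1})"
  by (rule has_field_derivative_transform_within[OF integral_has_real_derivative[OF assms], of 1])
     (use assms(2) in \<open>simp_all add: prim_eq_integral L2_continuous assms(1)\<close>)

lemma prim_deriv:
  assumes "\<And>x. x \<in> {0..1} \<Longrightarrow> (w has_real_derivative w' x) (at x within {0..1})"
    and "continuous_on {0..1} w'" "x \<in> {0..1}"
  shows "prim w' x = w x - w 0"
proof -
  have "(w' has_integral w x - w 0) {0..x}"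
    using assms(1,3)
    by (intro fundamental_theorem_of_calculus)
       (auto simp flip: has_real_derivative_iff_has_vector_derivative
         intro!: has_field_derivative_subset[OF assms(1)])
  then show ?thesis
    using assms by (simp add: prim_eq_integral L2_continuous integral_unique)
qed

lemma integral_indicator_greater:
  assumes "h \<in> L2"
  shows "(LINT x|leb\<Omega>. indicator {t<..} x * h x) = prim h 1 - prim h t"
proof -
  have "AE x in leb\<Omega>. x \<noteq> t"
    by (intro AE_leb_of_AE_lborel AE_lborel_singleton)
  then have "AE x in leb\<Omega>. indicator {t<..} x * h x = h x - indicator {..<t} x * h x"
    by eventually_elim (auto simp: indicator_def)
  then have "(LINT x|leb\<Omega>. indicator {t<..} x * h x)
      = (LINT x|leb\<Omega>. h x - indicator {..<t} x * h x)"
    using assms by (intro integral_cong_AE borel_measurable_integrable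
      Bochner_Integration.integrable_diff integrable_indicator_mult L2_integrable) auto
  then show ?thesis
    using assms by (simp add: prim_1 prim_def[of h t] integrable_indicator_mult L2_integrable)
qed

text \<open>The two terms are the integrals of \<open>g t * h x\<close> over the two triangles \<open>t < x\<close> and \<open>x < t\<close> of the
  unit square, which together make up the product of the full integrals. Arguing by Fubini's theorem instead of the product
  rule makes the formula cover all absolutely continuous functions with square integrable derivatives.\<close>

lemma integration_by_parts_prim:
  assumes g: "g \<in> L2" and h: "h \<in> L2"
  shows "ip (prim g) h + ip g (prim h) = prim g 1 * prim h 1"
proof -
  interpret finite_measure leb\<Omega> by (rule finite_measure_leb)
  interpret P: pair_sigma_finite leb\<Omega> leb\<Omega> ..
  have m [measurable]: "g \<in> borel_measurable leb\<Omega>" "h \<in> borel_measurable leb\<Omega>"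
    using g h L2D by auto
  have id [measurable]: "(\<lambda>x. x) \<in> leb\<Omega> \<rightarrow>\<^sub>M borel"
    by (intro continuous_imp_measurable_on_sets_lebesgue continuous_intros) simp
  define f where "f = (\<lambda>t x. (if t < x then g t * h x else 0))"
  have int: "integrable (leb\<Omega> \<Otimes>\<^sub>M leb\<Omega>) (case_prod f)"
  proof (rule Bochner_Integration.integrable_bound)
    show "integrable (leb\<Omega> \<Otimes>\<^sub>M leb\<Omega>) (\<lambda>(t, x). g t * h x)"
    proof (rule P.Fubini_integrable)
      show "integrable leb\<Omega> (\<lambda>x. LINT y|leb\<Omega>. norm (case (x, y) of (t, x) \<Rightarrow> g t * h x))"
        using g by (simp add: abs_mult L2_integrable)
    qed (use h in \<open>simp_all add: L2_integrable\<close>)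
    show "AE p in leb\<Omega> \<Otimes>\<^sub>M leb\<Omega>. norm (case_prod f p) \<le> norm (case p of (t, x) \<Rightarrow> g t * h x)"
      by (auto simp: f_def)
    show "case_prod f \<in> borel_measurable (leb\<Omega> \<Otimes>\<^sub>M leb\<Omega>)"
      unfolding f_def by measurable
  qed
  have "ip (prim g) h = (LINT x|leb\<Omega>. LINT t|leb\<Omega>. f t x)"
    unfolding ip_def prim_def f_def
    by (rule Bochner_Integration.integral_cong)
       (auto simp flip: integral_mult_left_zero
         intro!: Bochner_Integration.integral_cong simp: indicator_def)
  also have "\<dots> = (LINT t|leb\<Omega>. LINT x|leb\<Omega>. f t x)"
    by (rule P.Fubini_integral[OF int])
  also have "\<dots> = (LINT t|leb\<Omega>. g t * (LINT x|leb\<Omega>. indicator {t<..} x * h x))"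
    unfolding f_def
    by (rule Bochner_Integration.integral_cong)
       (auto simp flip: integral_mult_right_zero
         intro!: Bochner_Integration.integral_cong simp: indicator_def)
  also have "\<dots> = (LINT t|leb\<Omega>. g t * prim h 1 - g t * prim h t)"
    by (simp only: integral_indicator_greater[OF h] right_diff_distrib)
  also have "\<dots> = prim g 1 * prim h 1 - ip g (prim h)"
    using g h ip_integrable[OF g prim_L2[OF h]]
    by (simp add: L2_integrable prim_1[of g] ip_def)
  finally show ?thesis by simp
qed

section \<open>Weak derivatives\<close>

lemma has_weak_deriv_1: "has_weak_deriv 1 w g \<longleftrightarrow> (\<forall>\<phi>\<in>test_functions. ip w (deriv \<phi>) = - ip g \<phi>)"
  by (simp add: has_weak_deriv_def)

lemma has_weak_deriv_2:
  "has_weak_deriv 2 w g \<longleftrightarrow> (\<forall>\<phi>\<in>test_functions. ip w (deriv (deriv \<phi>)) = ip g \<phi>)"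
  by (simp add: has_weak_deriv_def numeral_2_eq_2)

lemma has_weak_deriv_add:
  assumes "has_weak_deriv k w g" "has_weak_deriv k z h" "w \<in> L2" "g \<in> L2" "z \<in> L2" "h \<in> L2"
  shows "has_weak_deriv k (\<lambda>x. w x + z x) (\<lambda>x. g x + h x)"
  using assms unfolding has_weak_deriv_def
  by (simp add: ip_add test_L2 test_higher_deriv distrib_left)

lemma has_weak_deriv_scale:
  "has_weak_deriv k w g \<Longrightarrow> has_weak_deriv k (\<lambda>x. c * w x) (\<lambda>x. c * g x)"
  unfolding has_weak_deriv_def by (simp add: ip_scale)

lemma has_weak_deriv_diff:
  assumes "has_weak_deriv k w g" "has_weak_deriv k z h" "w \<in> L2" "g \<in> L2" "z \<in> L2" "h \<in> L2"
  shows "has_weak_deriv k (\<lambda>x. w x - z x) (\<lambda>x. g x - h x)"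
  using assms unfolding has_weak_deriv_def
  by (simp add: ip_diff test_L2 test_higher_deriv right_diff_distrib)

lemma has_weak_deriv_cong:
  assumes "has_weak_deriv k w g" "ae_eq w z" "w \<in> L2" "z \<in> L2"
  shows "has_weak_deriv k z g"
  using assms(1) ip_cong[OF assms(2-4)] unfolding has_weak_deriv_def
  by (simp add: test_L2 test_higher_deriv)

text \<open>Derivatives of test functions are test functions, so weak derivatives may be taken one at a time.\<close>

lemma has_weak_deriv_comp:
  "has_weak_deriv 1 w g \<Longrightarrow> has_weak_deriv 1 g h \<Longrightarrow> has_weak_deriv 2 w h"
  unfolding has_weak_deriv_1 has_weak_deriv_2 by (simp add: test_deriv)

lemma has_weak_deriv_unique:
  assumes "has_weak_deriv k w g" "has_weak_deriv k w h" "g \<in> L2" "h \<in> L2"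
  shows "ae_eq g h"
proof -
  have "ip (\<lambda>x. g x - h x) \<phi> = 0" if "\<phi> \<in> test_functions" for \<phi>
    using assms that by (simp add: has_weak_deriv_def ip_diff test_L2)
  then have "ae_eq (\<lambda>x. g x - h x) (\<lambda>x. 0)"
    using assms by (intro fundamental_lemma L2_integrable L2_diff)
  then show ?thesis by (simp add: ae_eq_def)
qed

lemma test_prim_deriv:
  assumes "\<phi> \<in> test_functions" "x \<in> {0..1}" shows "prim (deriv \<phi>) x = \<phi> x"
  using assms prim_deriv[of \<phi> "deriv \<phi>" x] test_zero[of \<phi> 0]
  by (simp add: test_DERIV test_continuous test_deriv has_field_derivative_at_within \<Omega>_def)

text \<open>Integration by parts against \<open>\<phi>'\<close>, whose primitive is \<open>\<phi>\<close>; the boundary term carries the factor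
  \<open>\<phi> 1 = 0\<close>.\<close>

lemma has_weak_deriv_prim:
  assumes g: "g \<in> L2" shows "has_weak_deriv 1 (prim g) g"
  unfolding has_weak_deriv_1
proof
  fix \<phi> assume \<phi>: "\<phi> \<in> test_functions"
  have "ip (prim g) (deriv \<phi>) + ip g (prim (deriv \<phi>)) = 0"
    using integration_by_parts_prim[OF g test_L2[OF test_deriv[OF \<phi>]]]
      test_prim_deriv[OF \<phi>, of 1] test_zero[OF \<phi>, of 1]
    by (simp add: \<Omega>_def)
  moreover have "ip g (prim (deriv \<phi>)) = ip g \<phi>"
    unfolding ip_def using test_prim_deriv[OF \<phi>]
    by (intro Bochner_Integration.integral_cong) (auto simp: \<Omega>_def)
  ultimately show "ip (prim g) (deriv \<phi>) = - ip g \<phi>" by simp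
qed

lemma has_weak_deriv_C1:
  assumes w: "\<And>x. x \<in> {0..1} \<Longrightarrow> (w has_real_derivative w' x) (at x within {0..1})"
    and w': "continuous_on {0..1} w'"
  shows "has_weak_deriv 1 w w'"
proof -
  have L2: "w \<in> L2" "w' \<in> L2"
    by (intro L2_continuous DERIV_continuous_on[OF w] w'; assumption)+
  have "has_weak_deriv 1 (\<lambda>x. w 0) (\<lambda>x. 0)"
    unfolding has_weak_deriv_1
  proof
    fix \<phi> assume \<phi>: "\<phi> \<in> test_functions"
    then show "ip (\<lambda>x. w 0) (deriv \<phi>) = - ip (\<lambda>x. 0) \<phi>"
      using prim_1[of "deriv \<phi>"] test_prim_deriv[OF \<phi>, of 1] test_zero[OF \<phi>, of 1]
      by (simp add: ip_def \<Omega>_def)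
  qed
  from has_weak_deriv_add[OF this has_weak_deriv_prim[OF L2(2)]] L2
  have "has_weak_deriv 1 (\<lambda>x. w 0 + prim w' x) w'"
    by (simp add: L2_const prim_L2)
  moreover have "ae_eq (\<lambda>x. w 0 + prim w' x) w"
    by (rule ae_eqI) (use prim_deriv[OF w w'] in \<open>simp add: \<Omega>_def\<close>)
  ultimately show ?thesis
    by (rule has_weak_deriv_cong) (simp_all add: L2 L2_add L2_const prim_L2)
qed

text \<open>The primitive vanishes to the left of the support and equals the mean of \<open>\<psi>\<close> to the right of it;
  the mean is therefore the one obstruction to a compactly supported antiderivative.\<close>

lemma test_antiderivative:
  assumes \<psi>: "\<psi> \<in> test_functions" and mean: "ip (\<lambda>x. 1) \<psi> = 0"
  shows "prim \<psi> \<in> test_functions" "deriv (prim \<psi>) = \<psi>"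
proof -
  define K where "K = closure {x. \<psi> x \<noteq> 0}"
  have K: "K \<subseteq> {0<..<1}" "closed K" using \<psi> by (auto simp: K_def test_functions_iff \<Omega>_def)
  then have "compact K"
    using bounded_subset[of "{0<..<1::real}" K] by (auto simp: compact_eq_bounded_closed)
  obtain a b where ab: "0 < a" "b < 1" "K \<subseteq> {a..b}"
  proof (cases "K = {}")
    case True
    then show ?thesis by (intro that[of "1/2" "1/2"]) auto
  next
    case False
    from compact_attains_inf[OF \<open>compact K\<close> False] compact_attains_sup[OF \<open>compact K\<close> False]
    obtain a b where "a \<in> K" "b \<in> K" "\<forall>x\<in>K. a \<le> x" "\<forall>x\<in>K. x \<le> b" by blast
    with K show ?thesis by (intro that[of a b]) auto
  qed
  have out: "\<psi> x = 0" if "x \<notin> {a..b}" for x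
    using that ab(3) closure_subset[of "{x. \<psi> x \<noteq> 0}"] by (auto simp: K_def)
  have left: "prim \<psi> x = 0" if "x < a" for x
  proof -
    have "prim \<psi> x = (LINT t|leb\<Omega>. 0)"
      unfolding prim_def
      by (rule Bochner_Integration.integral_cong) (use out that in \<open>auto simp: indicator_def\<close>)
    then show ?thesis by simp
  qed
  have right: "prim \<psi> x = 0" if "x > b" for x
  proof -
    have "prim \<psi> x = ip (\<lambda>x. 1) \<psi>"
      unfolding prim_def ip_def
      by (rule Bochner_Integration.integral_cong) (use out that in \<open>auto simp: indicator_def\<close>)
    then show ?thesis using mean by simp
  qed
  have D: "(prim \<psi> has_real_derivative \<psi> x) (at x)" for x
  proof -
    consider "x < a" | "x > b" | "x \<in> {0<..<1}" using ab by force
    then show ?thesis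
    proof cases
      case 1
      have "((\<lambda>x. 0) has_real_derivative 0) (at x)" by simp
      then have "(prim \<psi> has_real_derivative 0) (at x)"
        by (rule has_field_derivative_transform_within_open[of _ _ _ "{..<a}"]) (use 1 left in auto)
      with 1 out[of x] show ?thesis by simp
    next
      case 2
      have "((\<lambda>x. 0) has_real_derivative 0) (at x)" by simp
      then have "(prim \<psi> has_real_derivative 0) (at x)"
        by (rule has_field_derivative_transform_within_open[of _ _ _ "{b<..}"]) (use 2 right in auto)
      with 2 out[of x] show ?thesis by simp
    next
      case 3
      then have "at x within {0..1} = at x" by (intro at_within_interior) auto
      with DERIV_prim[of \<psi> x] 3 \<psi> show ?thesis by (auto simp: test_continuous)
    qed
  qed
  then show d: "deriv (prim \<psi>) = \<psi>" by (auto intro: DERIV_imp_deriv)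
  have "smooth (prim \<psi>)"
    using D d \<psi> by (subst smooth_iff_deriv) (auto simp: real_differentiable_def test_functions_iff)
  moreover have "closure {x. prim \<psi> x \<noteq> 0} \<subseteq> {a..b}"
    by (rule closure_minimal) (use left right in force)+
  ultimately show "prim \<psi> \<in> test_functions"
    using ab by (auto simp: test_functions_iff \<Omega>_def)
qed

text \<open>If all test functions had mean zero, the fundamental lemma would make the constant 1 vanish.\<close>

lemma unit_mean_test:
  obtains b where "b \<in> test_functions" "ip (\<lambda>x. 1) b = 1"
proof -
  have "\<not> ae_eq (\<lambda>x. 1) (\<lambda>x. 0)"
  proof
    assume "ae_eq (\<lambda>x. 1) (\<lambda>x. 0)"
    then have "ip (\<lambda>x. 1) (\<lambda>x. 1) = ip (\<lambda>x. 0) (\<lambda>x. 1)"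
      by (intro ip_cong L2_const)
    then show False by (simp add: ip_def \<Omega>_def measure_restrict_space)
  qed
  then obtain \<phi> where \<phi>: "\<phi> \<in> test_functions" "ip (\<lambda>x. 1) \<phi> \<noteq> 0"
    using fundamental_lemma[of "\<lambda>x. 1"] L2_integrable[OF L2_const[of 1]] by auto
  then have "(\<lambda>x. 1 / ip (\<lambda>x. 1) \<phi> * \<phi> x) \<in> test_functions"
    using test_lincomb[OF \<phi>(1) \<phi>(1), of "1 / ip (\<lambda>x. 1) \<phi>" 0] by simp
  moreover have "ip (\<lambda>x. 1) (\<lambda>x. 1 / ip (\<lambda>x. 1) \<phi> * \<phi> x) = 1"
    unfolding ip_scale(2) using \<phi>(2) by simp
  ultimately show ?thesis by (rule that)
qed

text \<open>A fixed test function of mean 1 removes the mean of any other, after which an antiderivative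
  exists among the test functions.\<close>

lemma mean_correction:
  assumes b: "b \<in> test_functions" "ip (\<lambda>x. 1) b = 1" and \<psi>: "\<psi> \<in> test_functions"
  obtains \<phi> where "\<phi> \<in> test_functions" "deriv \<phi> = (\<lambda>x. \<psi> x - ip (\<lambda>x. 1) \<psi> * b x)"
proof -
  define \<theta> where "\<theta> = (\<lambda>x. \<psi> x - ip (\<lambda>x. 1) \<psi> * b x)"
  have "\<theta> \<in> test_functions"
    using test_lincomb[OF \<psi> b(1), of 1 "- ip (\<lambda>x. 1) \<psi>"] by (simp add: \<theta>_def)
  moreover have "ip (\<lambda>x. 1) \<theta> = 0"
    using b \<psi> by (simp add: \<theta>_def ip_diff ip_scale L2_scale L2_const test_L2)
  ultimately show ?thesis
    using test_antiderivative[of \<theta>] that[of "prim \<theta>"] by (simp add: \<theta>_def)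
qed

text \<open>The lemma of du Bois-Reymond. Let \<open>b\<close> be a test function of mean 1. Testing with the antiderivative of \<open>\<psi> - \<langle>1, \<psi>\<rangle> b\<close> gives
  \<open>\<langle>w, \<psi>\<rangle> = \<langle>1, \<psi>\<rangle> \<langle>w, b\<rangle>\<close>, so \<open>w\<close> acts on all test functions like the constant \<open>\<langle>w, b\<rangle>\<close>.\<close>

lemma has_weak_deriv_zero_imp_const:
  assumes w: "w \<in> L2" "has_weak_deriv 1 w (\<lambda>x. 0)"
  shows "\<exists>c. ae_eq w (\<lambda>x. c)"
proof -
  obtain b where b: "b \<in> test_functions" "ip (\<lambda>x. 1) b = 1" by (rule unit_mean_test)
  have "ip (\<lambda>x. w x - ip w b * 1) \<psi> = 0" if \<psi>: "\<psi> \<in> test_functions" for \<psi>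
  proof -
    obtain \<phi> where \<phi>: "\<phi> \<in> test_functions" "deriv \<phi> = (\<lambda>x. \<psi> x - ip (\<lambda>x. 1) \<psi> * b x)"
      using mean_correction[OF b \<psi>] .
    have "0 = ip w (deriv \<phi>)"
      using w(2) \<phi>(1) unfolding has_weak_deriv_1 by simp
    also have "\<dots> = ip w \<psi> - ip (\<lambda>x. 1) \<psi> * ip w b"
      unfolding \<phi>(2) using w b \<psi> by (simp add: ip_diff ip_scale L2_scale test_L2)
    finally show ?thesis
      using w \<psi> unfolding ip_diff(1)[OF w(1) L2_scale[OF L2_const] test_L2[OF \<psi>]] ip_scale(1)
      by simp
  qed
  then have "ae_eq (\<lambda>x. w x - ip w b * 1) (\<lambda>x. 0)"
    using w by (intro fundamental_lemma L2_integrable L2_diff L2_scale L2_const)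
  then show ?thesis by (auto simp: ae_eq_def)
qed

text \<open>The same mean correction by a test function \<open>b\<close> of mean 1, applied one derivative higher, gives \<open>\<langle>w, \<psi>'\<rangle> = k \<langle>1, \<psi>\<rangle>\<close> with
  \<open>k = \<langle>w, b'\<rangle>\<close>. So \<open>w\<close> has the constant weak derivative \<open>- k\<close>, and the first-order lemma applies to \<open>w + k x\<close>.\<close>

lemma has_weak_deriv_2_zero_imp_affine:
  assumes w: "w \<in> L2" "has_weak_deriv 2 w (\<lambda>x. 0)"
  shows "\<exists>A B. ae_eq w (\<lambda>x. A + B * x)"
proof -
  obtain b where b: "b \<in> test_functions" "ip (\<lambda>x. 1) b = 1" by (rule unit_mean_test)
  define k where "k = ip w (deriv b)"
  have "has_weak_deriv 1 w (\<lambda>x. - k * 1)"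
    unfolding has_weak_deriv_1
  proof
    fix \<psi> assume \<psi>: "\<psi> \<in> test_functions"
    obtain \<phi> where \<phi>: "\<phi> \<in> test_functions" "deriv \<phi> = (\<lambda>x. \<psi> x - ip (\<lambda>x. 1) \<psi> * b x)"
      using mean_correction[OF b \<psi>] .
    have "deriv (deriv \<phi>) = (\<lambda>x. deriv \<psi> x - ip (\<lambda>x. 1) \<psi> * deriv b x)"
      unfolding \<phi>(2) using \<psi> b
      by (auto intro!: DERIV_imp_deriv derivative_eq_intros test_DERIV)
    moreover have "ip w (deriv (deriv \<phi>)) = 0"
      using w(2) \<phi>(1) unfolding has_weak_deriv_2 by simp
    ultimately show "ip w (deriv \<psi>) = - ip (\<lambda>x. - k * 1) \<psi>"
      using w b \<psi> unfolding ip_scale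
      by (simp add: ip_diff ip_scale L2_scale test_L2 test_deriv k_def)
  qed
  moreover have "has_weak_deriv 1 (\<lambda>x. - k * x) (\<lambda>x. - k * 1)"
    by (intro has_weak_deriv_scale has_weak_deriv_C1) (auto intro!: derivative_eq_intros)
  moreover have L2: "(\<lambda>x. - k * x) \<in> L2"
    by (intro L2_continuous continuous_intros)
  ultimately have "has_weak_deriv 1 (\<lambda>x. w x - - k * x) (\<lambda>x. 0)"
    using has_weak_deriv_diff[of 1 w "\<lambda>x. - k * 1" "\<lambda>x. - k * x" "\<lambda>x. - k * 1"] w L2_const
    by simp
  from has_weak_deriv_zero_imp_const[OF L2_diff[OF w(1) L2] this]
  obtain A where "ae_eq (\<lambda>x. w x - - k * x) (\<lambda>x. A)" ..
  then have "ae_eq w (\<lambda>x. A + (- k) * x)"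
    unfolding ae_eq_def by eventually_elim simp
  then show ?thesis by blast
qed

text \<open>The double primitive of \<open>g\<close> has the weak second derivative \<open>g\<close>, so its difference from \<open>w\<close> is affine.\<close>

lemma has_weak_deriv_2_repr:
  assumes "w \<in> L2" "g \<in> L2" "has_weak_deriv 2 w g"
  shows "\<exists>A B. ae_eq w (\<lambda>x. A + B * x + prim (prim g) x)"
proof -
  have "has_weak_deriv 2 (prim (prim g)) g"
    using assms by (intro has_weak_deriv_comp[OF has_weak_deriv_prim has_weak_deriv_prim] prim_L2)
  then have "has_weak_deriv 2 (\<lambda>x. w x - prim (prim g) x) (\<lambda>x. 0)"
    using has_weak_deriv_diff[OF assms(3), of "prim (prim g)" g] assms by (simp add: prim_L2)
  from has_weak_deriv_2_zero_imp_affine[OF L2_diff[OF assms(1) prim_L2[OF prim_L2[OF assms(2)]]] this]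
  obtain A B where "ae_eq (\<lambda>x. w x - prim (prim g) x) (\<lambda>x. A + B * x)" by blast
  then have "ae_eq w (\<lambda>x. A + B * x + prim (prim g) x)"
    unfolding ae_eq_def by eventually_elim simp
  then show ?thesis by blast
qed

section \<open>Sobolev functions and Green's formula\<close>

text \<open>The difference is continuous and has zero primitive; differentiating the primitive recovers it
  at every point.\<close>

lemma continuous_ae_eq:
  assumes f: "continuous_on {0..1} f" and g: "continuous_on {0..1} g"
    and eq: "ae_eq f g" and x: "x \<in> {0..1}"
  shows "f x = g x"
proof -
  define d where "d = (\<lambda>x. f x - g x)"
  have "prim d z = 0" for z
    unfolding prim_def
  proof (rule integral_eq_zero_AE)
    show "AE t in leb\<Omega>. indicator {..<z} t * d t = 0"
      using eq unfolding ae_eq_def by eventually_elim (simp add: d_def)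
  qed
  then have "prim d = (\<lambda>x. 0)" by blast
  moreover have "(prim d has_real_derivative d x) (at x within {0..1})"
    by (rule DERIV_prim) (use f g x in \<open>auto simp: d_def intro!: continuous_intros\<close>)
  ultimately have "d x = 0"
    using vector_derivative_unique_within_closed_interval[of 0 1 x "\<lambda>x. 0" "d x" 0] x
    by (simp add: has_real_derivative_iff_has_vector_derivative)
  then show ?thesis by (simp add: d_def)
qed

lemma sobolev_L2: "w \<in> sobolev m \<Longrightarrow> w \<in> L2"
  by (simp add: sobolev_def)

lemma sobolev_weak_deriv:
  assumes "w \<in> sobolev 2"
  shows "weak_deriv 2 w \<in> L2" "has_weak_deriv 2 w (weak_deriv 2 w)"
proof -
  have "\<exists>g. g \<in> L2 \<and> has_weak_deriv 2 w g"
    using assms by (auto simp: sobolev_def)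
  from someI_ex[OF this] show "weak_deriv 2 w \<in> L2" "has_weak_deriv 2 w (weak_deriv 2 w)"
    by (simp_all add: weak_deriv_def)
qed

lemma H2_0_L2: "u \<in> H2_0 \<Longrightarrow> u \<in> L2"
  using sobolev_L2[of u 2] by (simp add: H2_0_def)

lemma sobolevI:
  assumes "w \<in> L2" "g \<in> L2" "h \<in> L2" "has_weak_deriv 1 w g" "has_weak_deriv 1 g h"
  shows "w \<in> sobolev 2"
proof -
  have "\<exists>g\<in>L2. has_weak_deriv k w g" if k: "k \<le> 2" for k
  proof -
    consider "k = 0" | "k = 1" | "k = 2" using k by linarith
    then show ?thesis
    proof cases
      case 1
      have "has_weak_deriv 0 w w" by (simp add: has_weak_deriv_def)
      with 1 assms show ?thesis by blast
    next
      case 2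
      with assms show ?thesis by blast
    next
      case 3
      with assms has_weak_deriv_comp show ?thesis by blast
    qed
  qed
  with assms show ?thesis by (simp add: sobolev_def)
qed

lemma sobolev_diff:
  assumes "w \<in> sobolev m" "z \<in> sobolev m" shows "(\<lambda>x. w x - z x) \<in> sobolev m"
proof -
  have L2: "w \<in> L2" "z \<in> L2" using assms by (auto intro: sobolev_L2)
  have "\<exists>g\<in>L2. has_weak_deriv k (\<lambda>x. w x - z x) g" if k: "k \<le> m" for k
  proof -
    obtain g h where "g \<in> L2" "has_weak_deriv k w g" "h \<in> L2" "has_weak_deriv k z h"
      using assms k unfolding sobolev_def by blast
    with L2 show ?thesis
      by (intro bexI[of _ "\<lambda>x. g x - h x"] has_weak_deriv_diff L2_diff)
  qed
  with L2 show ?thesis by (simp add: sobolev_def L2_diff)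
qed

lemma H2_0I:
  assumes "w \<in> sobolev 2" "ae_eq w W" "continuous_on {0..1} W'"
    and "\<And>x. x \<in> {0..1} \<Longrightarrow> (W has_real_derivative W' x) (at x within {0..1})"
    and "W 0 = 0" "W 1 = 0" "W' 0 = 0" "W' 1 = 0"
  shows "w \<in> H2_0"
  using assms unfolding H2_0_def by blast

lemma H2_0_diff:
  assumes "w \<in> H2_0" "z \<in> H2_0" shows "(\<lambda>x. w x - z x) \<in> H2_0"
proof -
  obtain W W' where W: "ae_eq w W" "W 0 = 0" "W 1 = 0" "W' 0 = 0" "W' 1 = 0"
    "\<And>x. x \<in> {0..1} \<Longrightarrow> (W has_real_derivative W' x) (at x within {0..1})"
    "continuous_on {0..1} W'"
    using assms(1) unfolding H2_0_def by blast
  obtain Z Z' where Z: "ae_eq z Z" "Z 0 = 0" "Z 1 = 0" "Z' 0 = 0" "Z' 1 = 0"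
    "\<And>x. x \<in> {0..1} \<Longrightarrow> (Z has_real_derivative Z' x) (at x within {0..1})"
    "continuous_on {0..1} Z'"
    using assms(2) unfolding H2_0_def by blast
  have "ae_eq (\<lambda>x. w x - z x) (\<lambda>x. W x - Z x)"
    using W(1) Z(1) unfolding ae_eq_def by eventually_elim simp
  moreover have "((\<lambda>x. W x - Z x) has_real_derivative W' x - Z' x) (at x within {0..1})"
    if "x \<in> {0..1}" for x
    using W(6)[OF that] Z(6)[OF that] by (rule DERIV_diff)
  moreover have "continuous_on {0..1} (\<lambda>x. W' x - Z' x)"
    using W(7) Z(7) by (rule continuous_on_diff)
  moreover have "(\<lambda>x. w x - z x) \<in> sobolev 2"
    using assms by (simp add: H2_0_def sobolev_diff)
  ultimately show ?thesis
    using W Z by (intro H2_0I[of _ "\<lambda>x. W x - Z x" "\<lambda>x. W' x - Z' x"]) simp_all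
qed

text \<open>The representative that is continuously differentiable on \<open>{0..1}\<close> agrees everywhere with the one of
  \<open>has_weak_deriv_2_repr\<close>, and so do their derivatives. The conditions at 0 kill the affine part, and those at 1 become
  conditions on the primitives of \<open>u''\<close>.\<close>

lemma H2_0_repr:
  assumes u: "u \<in> H2_0" and g: "g \<in> L2" "has_weak_deriv 2 u g"
  shows "ae_eq u (prim (prim g))" "prim g 1 = 0" "prim (prim g) 1 = 0"
proof -
  obtain W W' where W: "ae_eq u W" "W 0 = 0" "W 1 = 0" "W' 0 = 0" "W' 1 = 0"
    "\<And>x. x \<in> {0..1} \<Longrightarrow> (W has_real_derivative W' x) (at x within {0..1})"
    using u unfolding H2_0_def by blast
  obtain A B where AB: "ae_eq u (\<lambda>x. A + B * x + prim (prim g) x)"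
    using has_weak_deriv_2_repr[OF H2_0_L2[OF u] g] by blast
  have ae: "ae_eq W (\<lambda>x. A + B * x + prim (prim g) x)"
    using W(1) AB unfolding ae_eq_def by eventually_elim simp
  have eq: "W x = A + B * x + prim (prim g) x" if "x \<in> {0..1}" for x
    by (rule continuous_ae_eq[OF _ _ ae that])
       (auto intro!: continuous_intros continuous_prim prim_L2 g DERIV_continuous_on[OF W(6)])
  have eq': "W' x = B + prim g x" if x: "x \<in> {0..1}" for x
  proof -
    have "((\<lambda>x. A + B * x + prim (prim g) x) has_real_derivative B + prim g x) (at x within {0..1})"
      using x g by (auto intro!: derivative_eq_intros DERIV_prim continuous_prim)
    then have "(W has_real_derivative B + prim g x) (at x within {0..1})"
      by (rule has_field_derivative_transform_within[of _ _ _ _ 1]) (use x eq in auto)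
    with W(6)[OF x] show ?thesis
      using vector_derivative_unique_within_closed_interval[of 0 1 x W] x
      by (simp add: has_real_derivative_iff_has_vector_derivative)
  qed
  have "A = 0" "B = 0"
    using eq[of 0] eq'[of 0] W by (simp_all add: prim_0)
  then show "ae_eq u (prim (prim g))" "prim g 1 = 0" "prim (prim g) 1 = 0"
    using AB eq[of 1] eq'[of 1] W by simp_all
qed

text \<open>Both sides equal \<open>- \<langle>u', v'\<rangle>\<close> up to boundary terms, and all of these carry a boundary value of \<open>u\<close>
  or \<open>u'\<close>. The affine part of \<open>v\<close> contributes nothing, because \<open>u''\<close> is orthogonal to 1 and \<open>x\<close>.\<close>

lemma green_H2_0:
  assumes u: "u \<in> H2_0" and g: "g \<in> L2" "has_weak_deriv 2 u g"
    and v: "v \<in> L2" and h: "h \<in> L2" "has_weak_deriv 2 v h"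
  shows "ip u h = ip g v"
proof -
  note rep = H2_0_repr[OF u g]
  have uL2: "u \<in> L2" using u by (rule H2_0_L2)
  obtain A B where AB: "ae_eq v (\<lambda>x. A * 1 + B * x + prim (prim h) x)"
    using has_weak_deriv_2_repr[OF v h] by auto
  have x: "(\<lambda>x. x) \<in> L2" by (intro L2_continuous continuous_intros)
  have "ip u h = ip (prim (prim g)) h"
    using rep(1) uL2 g h by (intro ip_cong prim_L2)
  also have "\<dots> = - ip (prim g) (prim h)"
    using integration_by_parts_prim[OF prim_L2[OF g(1)] h(1)] rep by simp
  finally have 1: "ip u h = - ip (prim g) (prim h)" .
  have g1: "ip g (\<lambda>x. 1) = 0"
    using rep(2) by (simp add: ip_def prim_1)
  have "ip (prim g) (\<lambda>x. 1) = 0"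
    using rep(3) by (simp add: ip_def prim_1)
  then have "ip g (prim (\<lambda>x. 1)) = 0"
    using integration_by_parts_prim[OF g(1) L2_const[of 1]] rep by simp
  moreover have "ip g (prim (\<lambda>x. 1)) = ip g (\<lambda>x. x)"
    unfolding ip_def using prim_deriv[of "\<lambda>x. x" "\<lambda>x. 1"]
    by (intro Bochner_Integration.integral_cong) (auto simp: \<Omega>_def)
  ultimately have gx: "ip g (\<lambda>x. x) = 0" by simp
  have "ip v g = ip (\<lambda>x. A * 1 + B * x + prim (prim h) x) g"
    using AB v g h x by (intro ip_cong L2_add L2_scale prim_L2 L2_const)
  also have "\<dots> = A * ip (\<lambda>x. 1) g + B * ip (\<lambda>x. x) g + ip (prim (prim h)) g"
    using g h x by (simp only: ip_add ip_scale L2_add L2_scale prim_L2 L2_const)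
  also have "\<dots> = ip g (prim (prim h))"
    using g1 gx by (simp add: ip_commute)
  also have "\<dots> = - ip (prim g) (prim h)"
    using integration_by_parts_prim[OF g(1) prim_L2[OF h(1)]] rep by simp
  finally show ?thesis using 1 by (simp add: ip_commute)
qed

section \<open>Coercivity of the bilinear form\<close>

lemma weak_deriv_2_diff:
  assumes "w \<in> sobolev 2" "z \<in> sobolev 2"
  shows "ae_eq (weak_deriv 2 (\<lambda>x. w x - z x)) (\<lambda>x. weak_deriv 2 w x - weak_deriv 2 z x)"
proof (rule has_weak_deriv_unique)
  show "has_weak_deriv 2 (\<lambda>x. w x - z x) (\<lambda>x. weak_deriv 2 w x - weak_deriv 2 z x)"
    using assms by (intro has_weak_deriv_diff sobolev_weak_deriv sobolev_L2)
qed (use assms in \<open>auto intro: L2_diff sobolev_weak_deriv sobolev_diff\<close>)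

lemma V_memD:
  assumes "(u, v) \<in> V"
  shows "u \<in> H2_0" "u \<in> sobolev 2" "v \<in> sobolev 2" "u \<in> L2" "v \<in> L2"
    "weak_deriv 2 u \<in> L2" "weak_deriv 2 v \<in> L2"
  using assms by (auto simp: V_def H2_0_def intro: sobolev_L2 sobolev_weak_deriv)

text \<open>The chosen weak derivative is linear only almost everywhere, which suffices under the integral.\<close>

lemma bform_diff:
  assumes p1: "(u1, v1) \<in> V" and p2: "(u2, v2) \<in> V" and q: "q \<in> V"
  shows "bform \<epsilon> lam (\<lambda>x. u1 x - u2 x, \<lambda>x. v1 x - v2 x) q
    = bform \<epsilon> lam (u1, v1) q - bform \<epsilon> lam (u2, v2) q"
proof -
  obtain us vs where q_eq: "q = (us, vs)" by (cases q)
  note [simp] = V_memD[OF p1] V_memD[OF p2] V_memD[OF q[unfolded q_eq]]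
  define a where "a = \<epsilon> powr (3/2)"
  define c where "c = \<epsilon> powr (5/2)"
  let ?u = "\<lambda>x. u1 x - u2 x" and ?v = "\<lambda>x. v1 x - v2 x"
  define R where "R = (\<lambda>x. vs x - a * weak_deriv 2 us x)"
  define S where "S = (\<lambda>x. a * weak_deriv 2 vs x + 4 * us x)"
  have [simp]: "R \<in> L2" "S \<in> L2"
    unfolding R_def S_def by (intro L2_add L2_diff L2_scale; simp)+
  have ae: "ae_eq (weak_deriv 2 ?u) (\<lambda>x. weak_deriv 2 u1 x - weak_deriv 2 u2 x)"
    "ae_eq (weak_deriv 2 ?v) (\<lambda>x. weak_deriv 2 v1 x - weak_deriv 2 v2 x)"
    by (simp_all add: weak_deriv_2_diff)
  have [simp]: "weak_deriv 2 ?u \<in> L2" "weak_deriv 2 ?v \<in> L2"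
    by (simp_all add: sobolev_weak_deriv sobolev_diff)
  define r where "r = (\<lambda>u v x. v x - a * weak_deriv 2 u x)"
  define s where "s = (\<lambda>u v x. c * weak_deriv 2 v x + 4 * u x)"
  have [simp]: "r u1 v1 \<in> L2" "r u2 v2 \<in> L2" "r ?u ?v \<in> L2"
    "s u1 v1 \<in> L2" "s u2 v2 \<in> L2" "s ?u ?v \<in> L2"
    unfolding r_def s_def by (intro L2_add L2_diff L2_scale; simp)+
  have "ae_eq (r ?u ?v) (\<lambda>x. r u1 v1 x - r u2 v2 x)" "ae_eq (s ?u ?v) (\<lambda>x. s u1 v1 x - s u2 v2 x)"
    using ae unfolding ae_eq_def by (eventually_elim, simp add: r_def s_def right_diff_distrib)+
  then have "ip (r ?u ?v) R = ip (\<lambda>x. r u1 v1 x - r u2 v2 x) R"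
    "ip (s ?u ?v) S = ip (\<lambda>x. s u1 v1 x - s u2 v2 x) S"
    by (auto intro!: ip_cong L2_diff)
  then have "ip (r ?u ?v) R = ip (r u1 v1) R - ip (r u2 v2) R"
    "ip (s ?u ?v) S = ip (s u1 v1) S - ip (s u2 v2) S"
    by (simp_all add: ip_diff)
  moreover have "bform \<epsilon> lam (u, v) q = lam * ip (r u v) R + ip (s u v) S" for u v
    by (simp add: bform_def q_eq a_def c_def R_def S_def r_def s_def)
  ultimately show ?thesis by (simp add: right_diff_distrib)
qed

text \<open>With \<open>a = \<epsilon> powr (3/2)\<close>, \<open>g = u''\<close> and \<open>h = v''\<close>, Green's formula and \<open>v = r + a g\<close> give \<open>\<langle>u, h\<rangle> = \<langle>g, r\<rangle> + a \<parallel>g\<parallel>\<^sup>2\<close>. Expanding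
  \<open>\<parallel>2 a g + r\<parallel>\<^sup>2 \<ge> 0\<close> then bounds the cross term \<open>4 a (1 + \<epsilon>) \<langle>u, h\<rangle>\<close> below by \<open>- (1 + \<epsilon>) \<parallel>r\<parallel>\<^sup>2 \<ge> - 2 \<parallel>r\<parallel>\<^sup>2\<close>, which \<open>lam \<parallel>r\<parallel>\<^sup>2\<close>
  absorbs with one \<open>\<parallel>r\<parallel>\<^sup>2\<close> to spare.\<close>

lemma bform_coercive:
  assumes e: "0 < \<epsilon>" "\<epsilon> \<le> 1" and lam: "3 \<le> lam" and p: "(u, v) \<in> V"
  defines "r \<equiv> \<lambda>x. v x - \<epsilon> powr (3/2) * weak_deriv 2 u x"
  shows "ip r r + 16 * ip u u \<le> bform \<epsilon> lam (u, v) (u, v)"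
proof -
  note [simp] = V_memD[OF p]
  define a where "a = \<epsilon> powr (3/2)"
  define g where "g = weak_deriv 2 u"
  define h where "h = weak_deriv 2 v"
  have "\<epsilon> powr (1 + 3/2) = \<epsilon> * a"
    using e by (simp only: powr_add a_def) simp
  then have c: "\<epsilon> powr (5/2) = \<epsilon> * a" by simp
  have gh [simp]: "g \<in> L2" "h \<in> L2" by (simp_all add: g_def h_def)
  have r_eq: "r = (\<lambda>x. v x - a * g x)" by (simp add: r_def a_def g_def)
  have rL2 [simp]: "r \<in> L2" unfolding r_eq by (simp add: L2_diff L2_scale)
  have v_eq: "v = (\<lambda>x. r x + a * g x)" by (simp add: r_eq)
  have "ip u h = ip g v"
    unfolding g_def h_def using p
    by (intro green_H2_0) (auto intro: sobolev_weak_deriv)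
  also have "\<dots> = ip g r + a * ip g g"
    unfolding v_eq by (simp add: ip_add ip_scale L2_scale)
  finally have uh: "ip u h = ip g r + a * ip g g" .
  have "bform \<epsilon> lam (u, v) (u, v)
      = lam * ip r r + ip (\<lambda>x. \<epsilon> * a * h x + 4 * u x) (\<lambda>x. a * h x + 4 * u x)"
    by (simp add: bform_def c r_eq g_def h_def flip: a_def)
  also have "\<dots> = lam * ip r r + \<epsilon> * a\<^sup>2 * ip h h + 4 * a * (1 + \<epsilon>) * ip u h + 16 * ip u u"
    by (simp only: ip_add ip_scale L2_scale L2_add V_memD[OF p] gh ip_commute[of h u])
       (simp add: power2_eq_square algebra_simps)
  finally have B: "bform \<epsilon> lam (u, v) (u, v)
      = lam * ip r r + \<epsilon> * a\<^sup>2 * ip h h + 4 * a * (1 + \<epsilon>) * ip u h + 16 * ip u u" .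
  have "0 \<le> ip (\<lambda>x. 2 * a * g x + r x) (\<lambda>x. 2 * a * g x + r x)"
    by (rule ip_self_nonneg)
  also have "\<dots> = 4 * a * ip u h + ip r r"
    unfolding uh
    by (simp only: ip_add ip_scale L2_scale L2_add rL2 gh ip_commute[of r g])
       (simp add: algebra_simps)
  finally have "- ((1 + \<epsilon>) * ip r r) \<le> (1 + \<epsilon>) * (4 * a * ip u h)"
    using e mult_left_mono[of "- ip r r" "4 * a * ip u h" "1 + \<epsilon>"] by simp
  moreover have "(1 + \<epsilon>) * ip r r \<le> 2 * ip r r" "3 * ip r r \<le> lam * ip r r"
    using e lam by (auto intro!: mult_right_mono ip_self_nonneg)
  moreover have "0 \<le> \<epsilon> * a\<^sup>2 * ip h h"
    using e by (simp add: ip_self_nonneg)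
  ultimately show ?thesis
    unfolding B by (simp add: algebra_simps)
qed

text \<open>Coercivity gives \<open>r = 0\<close> and \<open>u = 0\<close>; then \<open>u'' = 0\<close>, and \<open>v = r + a u''\<close> vanishes as well.\<close>

lemma bform_definite:
  assumes e: "0 < \<epsilon>" "\<epsilon> \<le> 1" and lam: "3 \<le> lam" and p: "(u, v) \<in> V"
    and zero: "bform \<epsilon> lam (u, v) (u, v) = 0"
  shows "ae_eq u (\<lambda>x. 0)" "ae_eq v (\<lambda>x. 0)"
proof -
  note [simp] = V_memD[OF p]
  define r where "r = (\<lambda>x. v x - \<epsilon> powr (3/2) * weak_deriv 2 u x)"
  have rL2: "r \<in> L2" by (simp add: r_def L2_diff L2_scale)
  have "ip r r + 16 * ip u u \<le> 0"
    using bform_coercive[OF e lam p] zero by (simp add: r_def)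
  then have "ip r r = 0" "ip u u = 0"
    using ip_self_nonneg[of r] ip_self_nonneg[of u] by linarith+
  then have ae: "ae_eq r (\<lambda>x. 0)" "ae_eq u (\<lambda>x. 0)"
    using rL2 by (auto intro: ip_self_zero)
  then show "ae_eq u (\<lambda>x. 0)" by simp
  have "has_weak_deriv 2 u (\<lambda>x. 0)"
    by (rule has_weak_deriv_cong[OF _ ae_eq_sym[OF ae(2)]]) (simp_all add: has_weak_deriv_def L2_const)
  then have "ae_eq (weak_deriv 2 u) (\<lambda>x. 0)"
    by (intro has_weak_deriv_unique[OF sobolev_weak_deriv(2)]) (simp_all add: L2_const)
  with ae(1) show "ae_eq v (\<lambda>x. 0)"
    unfolding ae_eq_def by eventually_elim (simp add: r_def)
qed

section \<open>The clamped boundary value problem\<close>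

text \<open>Positivity of the determinant of the boundary conditions in \<open>clamped_ode\<close>.\<close>

lemma sin_less_sinh:
  fixes x :: real
  assumes "x > 0" shows "(sin x)\<^sup>2 < (sinh x)\<^sup>2"
proof -
  have "sinh 0 - 0 < sinh x - x"
  proof (rule DERIV_pos_imp_increasing_open[OF assms])
    show "\<exists>y. ((\<lambda>x. sinh x - x) has_real_derivative y) (at t) \<and> 0 < y" if "0 < t" for t :: real
      using that by (intro exI[of _ "cosh t - 1"]) (auto intro!: derivative_eq_intros simp: cosh_real_nonneg_less_iff[of 0, simplified])
  qed (auto intro!: continuous_intros)
  then have "x < sinh x" by simp
  then have "\<bar>sin x\<bar> < \<bar>sinh x\<bar>"
    using abs_sin_x_le_abs_x[of x] assms by simp
  then show ?thesis by (rule power2_strict_mono)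
qed

text \<open>The real and imaginary parts of \<open>y\<close> satisfy \<open>(Im y)'' = 2 \<kappa>\<^sup>2 (Re y + G)\<close> and
  \<open>(Re y)'' = - 2 \<kappa>\<^sup>2 Im y\<close>, so that \<open>u = Im y / (2 \<kappa>\<^sup>2)\<close> is the clamped solution of \<open>u'' = Re y + G\<close>,
  \<open>(u'' - G)'' = - 4 \<kappa>\<^sup>4 u\<close>. With \<open>\<alpha> = \<kappa> (1 + \<i>)\<close> and \<open>\<alpha>\<^sup>2 = 2 \<i> \<kappa>\<^sup>2\<close>, the equation
  is \<open>y'' = \<alpha>\<^sup>2 (y + G)\<close>, solved by variation of constants. Clamping at 0
  means that \<open>y 0\<close> and \<open>y' 0\<close> are real, which leaves two real parameters for the two conditions at 1.\<close>

lemma clamped_ode: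
  fixes \<kappa> :: real and G :: "real \<Rightarrow> real"
  assumes \<kappa>: "\<kappa> > 0" and G: "continuous_on {0..1} G"
  obtains y y' :: "real \<Rightarrow> complex" where
    "\<And>x. x \<in> {0..1} \<Longrightarrow> (y has_vector_derivative y' x) (at x within {0..1})"
    "\<And>x. x \<in> {0..1} \<Longrightarrow>
      (y' has_vector_derivative 2 * \<i> * \<kappa>\<^sup>2 * (y x + G x)) (at x within {0..1})"
    "Im (y 0) = 0" "Im (y 1) = 0" "Im (y' 0) = 0" "Im (y' 1) = 0"
proof -
  define \<alpha> where "\<alpha> = complex_of_real \<kappa> * (1 + \<i>)"
  have \<alpha>0: "\<alpha> \<noteq> 0" using \<kappa> by (simp add: \<alpha>_def complex_eq_iff)
  have \<alpha>2: "2 * \<i> * \<kappa>\<^sup>2 = \<alpha> * \<alpha>"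
    by (simp add: \<alpha>_def power2_eq_square algebra_simps)
  \<comment> \<open>Variation of constants for the fundamental system \<open>exp (\<alpha> x)\<close> and \<open>exp (- \<alpha> x)\<close>; with the coefficients below,
    \<open>d\<close> and \<open>e\<close> are the initial values \<open>y 0\<close> and \<open>y' 0\<close>.\<close>
  define P where "P = (\<lambda>x. integral {0..x} (\<lambda>t. exp (- \<alpha> * t) * G t))"
  define Q where "Q = (\<lambda>x. integral {0..x} (\<lambda>t. exp (\<alpha> * t) * G t))"
  have P': "(P has_vector_derivative exp (- \<alpha> * x) * G x) (at x within {0..1})"
    and Q': "(Q has_vector_derivative exp (\<alpha> * x) * G x) (at x within {0..1})"
    if "x \<in> {0..1}" for x
    unfolding P_def Q_def using that
    by (auto intro!: integral_has_vector_derivative continuous_intros G)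
  have exp': "((\<lambda>x. exp (c * complex_of_real x)) has_vector_derivative c * exp (c * x)) (at x within {0..1})"
    for c x
    by (auto intro!: derivative_eq_intros has_vector_derivative_real_field)
  define Y where "Y = (\<lambda>d e x. exp (\<alpha> * x) * ((d + e / \<alpha>) / 2 + \<alpha> / 2 * P x)
      + exp (- \<alpha> * x) * ((d - e / \<alpha>) / 2 - \<alpha> / 2 * Q x))"
  define Y' where "Y' = (\<lambda>d e x. \<alpha> * (exp (\<alpha> * x) * ((d + e / \<alpha>) / 2 + \<alpha> / 2 * P x)
      - exp (- \<alpha> * x) * ((d - e / \<alpha>) / 2 - \<alpha> / 2 * Q x)))"
  have dY: "(Y d e has_vector_derivative Y' d e x) (at x within {0..1})"
    and dY': "(Y' d e has_vector_derivative \<alpha> * \<alpha> * (Y d e x + G x)) (at x within {0..1})"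
    if x: "x \<in> {0..1}" for d e :: complex and x
  proof -
    have 1: "((\<lambda>x. exp (\<alpha> * x) * ((d + e / \<alpha>) / 2 + \<alpha> / 2 * P x)) has_vector_derivative
        \<alpha> * (exp (\<alpha> * x) * ((d + e / \<alpha>) / 2 + \<alpha> / 2 * P x)) + \<alpha> / 2 * G x) (at x within {0..1})"
      by (rule has_vector_derivative_eq_rhs[OF has_vector_derivative_mult[OF exp'
            has_vector_derivative_add[OF has_vector_derivative_const
              has_vector_derivative_mult_right[OF P'[OF x]]]]])
         (simp add: algebra_simps exp_minus_inverse)
    have 2: "((\<lambda>x. exp (- \<alpha> * x) * ((d - e / \<alpha>) / 2 - \<alpha> / 2 * Q x)) has_vector_derivative
        - \<alpha> * (exp (- \<alpha> * x) * ((d - e / \<alpha>) / 2 - \<alpha> / 2 * Q x)) - \<alpha> / 2 * G x) (at x within {0..1})"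
      by (rule has_vector_derivative_eq_rhs[OF has_vector_derivative_mult[OF exp'
            has_vector_derivative_diff[OF has_vector_derivative_const
              has_vector_derivative_mult_right[OF Q'[OF x]]]]])
         (simp add: algebra_simps exp_minus_inverse)
    have alg: "\<alpha> * (\<alpha> * X + \<alpha> / 2 * g - (- \<alpha> * Z - \<alpha> / 2 * g)) = \<alpha> * \<alpha> * (X + Z + g)"
      "\<alpha> * X + \<alpha> / 2 * g + (- \<alpha> * Z - \<alpha> / 2 * g) = \<alpha> * (X - Z)"
      for X Z g :: complex
      by (simp_all add: field_simps)
    show "(Y d e has_vector_derivative Y' d e x) (at x within {0..1})"
      unfolding Y_def Y'_def
      by (rule has_vector_derivative_eq_rhs[OF has_vector_derivative_add[OF 1 2]])
         (rule alg(2))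
    show "(Y' d e has_vector_derivative \<alpha> * \<alpha> * (Y d e x + G x)) (at x within {0..1})"
      unfolding Y_def Y'_def
      by (rule has_vector_derivative_eq_rhs[OF
            has_vector_derivative_mult_right[OF has_vector_derivative_diff[OF 1 2]]])
         (rule alg(1))
  qed
  have at0: "Y d e 0 = d" "Y' d e 0 = e" for d e
    using \<alpha>0 by (simp_all add: Y_def Y'_def P_def Q_def field_simps)
  define s where "s = sin \<kappa>"
  define co where "co = cos \<kappa>"
  define sh where "sh = sinh \<kappa>"
  define ch where "ch = cosh \<kappa>"
  \<comment> \<open>The coefficients of the conditions at 1 are the imaginary parts of \<open>cosh \<alpha>\<close>, \<open>sinh \<alpha> / \<alpha>\<close> and
    \<open>\<alpha> * sinh \<alpha>\<close>.\<close>
  define A where "A = sh * s"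
  define B where "B = (ch * s - sh * co) / (2 * \<kappa>)"
  define C where "C = \<kappa> * (sh * co + ch * s)"
  have det: "A * A - B * C \<noteq> 0"
  proof -
    have sq: "co\<^sup>2 = 1 - s\<^sup>2" "ch\<^sup>2 = 1 + sh\<^sup>2"
      by (simp_all add: co_def s_def ch_def sh_def cos_squared_eq cosh_square_eq)
    have "A * A - B * C = sh\<^sup>2 * s\<^sup>2 - (ch\<^sup>2 * s\<^sup>2 - sh\<^sup>2 * co\<^sup>2) / 2"
      using \<kappa> by (simp add: A_def B_def C_def power2_eq_square field_simps)
    also have "\<dots> = (sh\<^sup>2 - s\<^sup>2) / 2"
      unfolding sq by (simp add: field_simps)
    finally have "A * A - B * C = (sh\<^sup>2 - s\<^sup>2) / 2" .
    with sin_less_sinh[OF \<kappa>] show ?thesis by (simp add: sh_def s_def)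
  qed
  have ex: "exp \<alpha> + exp (- \<alpha>) = 2 * Complex (ch * co) (sh * s)"
    "exp \<alpha> - exp (- \<alpha>) = 2 * Complex (sh * co) (ch * s)"
    by (simp_all add: \<alpha>_def s_def co_def sh_def ch_def sinh_field_def cosh_field_def complex_eq_iff
        Re_exp Im_exp algebra_simps)
  have at1: "Y d e 1 = d * Complex (ch * co) (sh * s) + e / \<alpha> * Complex (sh * co) (ch * s) + Y 0 0 1"
    "Y' d e 1 = \<alpha> * d * Complex (sh * co) (ch * s) + e * Complex (ch * co) (sh * s) + Y' 0 0 1" for d e
  proof -
    have "Y d e 1 = d * ((exp \<alpha> + exp (- \<alpha>)) / 2) + e / \<alpha> * ((exp \<alpha> - exp (- \<alpha>)) / 2) + Y 0 0 1"
      by (simp add: Y_def algebra_simps add_divide_distrib diff_divide_distrib)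
    then show "Y d e 1 = d * Complex (ch * co) (sh * s) + e / \<alpha> * Complex (sh * co) (ch * s) + Y 0 0 1"
      unfolding ex by simp
    have "Y' d e 1 = \<alpha> * d * ((exp \<alpha> - exp (- \<alpha>)) / 2) + e * ((exp \<alpha> + exp (- \<alpha>)) / 2) + Y' 0 0 1"
      using \<alpha>0 by (simp add: Y'_def field_simps)
    then show "Y' d e 1 = \<alpha> * d * Complex (sh * co) (ch * s) + e * Complex (ch * co) (sh * s) + Y' 0 0 1"
      unfolding ex by simp
  qed
  have inv\<alpha>: "1 / \<alpha> = Complex (1 / (2 * \<kappa>)) (- 1 / (2 * \<kappa>))"
    unfolding nonzero_divide_eq_eq[OF \<alpha>0] using \<kappa>
    by (simp add: \<alpha>_def complex_eq_iff)
  have Im1: "Im (Y (of_real d) (of_real e) 1) = d * A + e * B + Im (Y 0 0 1)"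
    "Im (Y' (of_real d) (of_real e) 1) = d * C + e * A + Im (Y' 0 0 1)" for d e :: real
  proof -
    have *: "of_real e / \<alpha> = of_real e * Complex (1 / (2 * \<kappa>)) (- 1 / (2 * \<kappa>))"
      unfolding inv\<alpha>[symmetric] by simp
    show "Im (Y (of_real d) (of_real e) 1) = d * A + e * B + Im (Y 0 0 1)"
      unfolding at1[of "of_real d" "of_real e"] *
      by (simp add: A_def B_def algebra_simps add_divide_distrib diff_divide_distrib)
    show "Im (Y' (of_real d) (of_real e) 1) = d * C + e * A + Im (Y' 0 0 1)"
      unfolding at1[of "of_real d" "of_real e"] by (simp add: A_def C_def \<alpha>_def algebra_simps)
  qed
  \<comment> \<open>Cramer's rule for the two conditions at 1.\<close>
  define D where "D = A * A - B * C"
  define m n where "m = Im (Y 0 0 1)" and "n = Im (Y' 0 0 1)"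
  define d e where "d = (B * n - A * m) / D" and "e = (C * m - A * n) / D"
  have "D \<noteq> 0" using det by (simp add: D_def)
  have "d * A + e * B + m = ((B * n - A * m) * A + (C * m - A * n) * B + m * D) / D"
    using \<open>D \<noteq> 0\<close> by (simp add: d_def e_def add_divide_distrib)
  also have "(B * n - A * m) * A + (C * m - A * n) * B + m * D = 0"
    by (simp add: D_def algebra_simps)
  finally have end1: "Im (Y (of_real d) (of_real e) 1) = 0"
    unfolding Im1 m_def by simp
  have "d * C + e * A + n = ((B * n - A * m) * C + (C * m - A * n) * A + n * D) / D"
    using \<open>D \<noteq> 0\<close> by (simp add: d_def e_def add_divide_distrib)
  also have "(B * n - A * m) * C + (C * m - A * n) * A + n * D = 0"
    by (simp add: D_def algebra_simps)
  finally have end2: "Im (Y' (of_real d) (of_real e) 1) = 0"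
    unfolding Im1 n_def by simp
  show ?thesis
    by (rule that[of "Y (of_real d) (of_real e)" "Y' (of_real d) (of_real e)"])
       (simp_all add: dY dY'[folded \<alpha>2] at0 end1 end2 del: of_real_power)
qed

text \<open>The datum of the boundary value problem is \<open>\<kappa>\<^sup>4\<close> times the double primitive of \<open>f\<close>. Thus \<open>w = u''\<close> is
  a twice continuously differentiable function plus this datum, and its weak second derivative is \<open>\<kappa>\<^sup>4 (f - 4 u)\<close>, which is
  the equation \<open>\<epsilon>\<^sup>4 u'''' + 4 u = f\<close>. Taking \<open>v = a w\<close> makes both residuals of the system vanish.\<close>

lemma solution_exists:
  assumes e: "0 < \<epsilon>" and f: "f \<in> L2"
  obtains u v where "(u, v) \<in> V" "\<And>p. p \<in> V \<Longrightarrow> bform \<epsilon> lam (u, v) p = rhs \<epsilon> f p"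
proof -
  define \<kappa> where "\<kappa> = 1 / \<epsilon>"
  have \<kappa>: "\<kappa> > 0" using e by (simp add: \<kappa>_def)
  have F: "prim f \<in> L2" "prim (prim f) \<in> L2" by (intro prim_L2 f)+
  define G where "G = (\<lambda>x. \<kappa> ^ 4 * prim (prim f) x)"
  have G: "continuous_on {0..1} G"
    unfolding G_def by (intro continuous_intros continuous_prim F)
  obtain y y' :: "real \<Rightarrow> complex" where
    y: "\<And>x. x \<in> {0..1} \<Longrightarrow> (y has_vector_derivative y' x) (at x within {0..1})" and
    y': "\<And>x. x \<in> {0..1} \<Longrightarrow>
      (y' has_vector_derivative 2 * \<i> * \<kappa>\<^sup>2 * (y x + G x)) (at x within {0..1})" and
    bc: "Im (y 0) = 0" "Im (y 1) = 0" "Im (y' 0) = 0" "Im (y' 1) = 0"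
    by (rule clamped_ode[OF \<kappa> G], rule that)
  have Re_Im: "((\<lambda>x. Re (z x)) has_real_derivative Re z') (at x within {0..1})"
    "((\<lambda>x. Im (z x)) has_real_derivative Im z') (at x within {0..1})"
    if "(z has_vector_derivative z') (at x within {0..1})" for z z' and x :: real
    using bounded_linear.has_vector_derivative[OF bounded_linear_Re that]
      bounded_linear.has_vector_derivative[OF bounded_linear_Im that]
    by (simp_all add: has_real_derivative_iff_has_vector_derivative)
  have cont: "continuous_on {0..1} y" "continuous_on {0..1} y'"
    by (rule continuous_on_vector_derivative, erule y, rule continuous_on_vector_derivative, erule y')
  define u where "u = (\<lambda>x. Im (y x) / (2 * \<kappa>\<^sup>2))"
  define u' where "u' = (\<lambda>x. Im (y' x) / (2 * \<kappa>\<^sup>2))"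
  define w where "w = (\<lambda>x. Re (y x) + \<kappa> ^ 4 * prim (prim f) x)"
  define w' where "w' = (\<lambda>x. Re (y' x) + \<kappa> ^ 4 * prim f x)"
  define w'' where "w'' = (\<lambda>x. - 4 * \<kappa> ^ 4 * u x + \<kappa> ^ 4 * f x)"
  have du: "(u has_real_derivative u' x) (at x within {0..1})" if "x \<in> {0..1}" for x
    unfolding u_def u'_def using Re_Im(2)[OF y[OF that]] by (intro DERIV_cdivide)
  have du': "(u' has_real_derivative w x) (at x within {0..1})" if "x \<in> {0..1}" for x
    using DERIV_cdivide[OF Re_Im(2)[OF y'[OF that]], of "2 * \<kappa>\<^sup>2"] \<kappa>
    by (simp add: u'_def w_def G_def)
  have dy: "((\<lambda>x. Re (y' x)) has_real_derivative - 4 * \<kappa> ^ 4 * u x) (at x within {0..1})"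
    if "x \<in> {0..1}" for x
    using Re_Im(1)[OF y'[OF that]] \<kappa>
    by (simp add: u_def power2_eq_square power4_eq_xxxx field_simps)
  have cont': "continuous_on {0..1} u" "continuous_on {0..1} u'"
    "continuous_on {0..1} (\<lambda>x. Re (y x))" "continuous_on {0..1} (\<lambda>x. Re (y' x))"
    unfolding u_def u'_def using cont \<kappa> by (auto intro!: continuous_intros)
  have contw: "continuous_on {0..1} w"
    unfolding w_def by (intro continuous_intros cont' continuous_prim F)
  note [simp] = cont'[THEN L2_continuous] L2_continuous[OF contw] F f
  have [simp]: "w' \<in> L2" "w'' \<in> L2"
    unfolding w'_def w''_def by (simp_all only: L2_add L2_scale cont'[THEN L2_continuous] F f)
  have weak: "has_weak_deriv 1 u u'" "has_weak_deriv 1 u' w"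
    by (rule has_weak_deriv_C1; use du du' cont' contw in blast)+
  have weak_w: "has_weak_deriv 1 w w'"
    unfolding w_def w'_def
    by (intro has_weak_deriv_add has_weak_deriv_scale has_weak_deriv_prim L2_scale has_weak_deriv_C1)
       (use Re_Im(1)[OF y] cont' in auto)
  have weak_w': "has_weak_deriv 1 w' w''"
    unfolding w'_def w''_def
    by (intro has_weak_deriv_add has_weak_deriv_scale has_weak_deriv_prim L2_scale has_weak_deriv_C1)
       (use dy cont' in \<open>auto intro!: continuous_intros\<close>)
  define a where "a = \<epsilon> powr (3/2)"
  define v where "v = (\<lambda>x. a * w x)"
  have u_sob: "u \<in> sobolev 2"
    using weak by (intro sobolevI[of u u' w]) simp_all
  have v_sob: "v \<in> sobolev 2"
    unfolding v_def using weak_w weak_w'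
    by (intro sobolevI[of _ "\<lambda>x. a * w' x" "\<lambda>x. a * w'' x"] L2_scale has_weak_deriv_scale) simp_all
  have "u \<in> H2_0"
    using bc by (intro H2_0I[OF u_sob _ cont'(2) du]) (simp_all add: ae_eq_def u_def u'_def)
  then have V: "(u, v) \<in> V" using v_sob by (simp add: V_def)
  note [simp] = V_memD[OF V]
  have u2: "ae_eq (weak_deriv 2 u) w"
    by (rule has_weak_deriv_unique[OF _ has_weak_deriv_comp[OF weak]]) (simp_all add: sobolev_weak_deriv)
  have v2: "ae_eq (weak_deriv 2 v) (\<lambda>x. a * w'' x)"
    by (rule has_weak_deriv_unique[OF _ has_weak_deriv_scale[OF has_weak_deriv_comp[OF weak_w weak_w'], of a, folded v_def]])
       (simp_all add: sobolev_weak_deriv L2_scale)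
  have "\<epsilon> powr (5/2) * a = \<epsilon> powr 4"
    unfolding a_def by (simp flip: powr_add)
  also have "\<dots> = \<epsilon> ^ 4" using e by simp
  finally have "\<epsilon> powr (5/2) * a * \<kappa> ^ 4 = 1"
    using e by (simp add: \<kappa>_def power_divide)
  then have c: "\<epsilon> powr (5/2) * (a * (\<kappa> ^ 4 * t)) = t" for t
    by (metis mult.assoc mult_1)
  have "bform \<epsilon> lam (u, v) p = rhs \<epsilon> f p" if p: "p \<in> V" for p
  proof -
    obtain us vs where p_eq: "p = (us, vs)" by (cases p)
    note [simp] = V_memD[OF p[unfolded p_eq]]
    define R where "R = (\<lambda>x. vs x - a * weak_deriv 2 us x)"
    define S where "S = (\<lambda>x. a * weak_deriv 2 vs x + 4 * us x)"
    have RS: "R \<in> L2" "S \<in> L2"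
      unfolding R_def S_def by (intro L2_add L2_diff L2_scale; simp)+
    have "ip (\<lambda>x. v x - a * weak_deriv 2 u x) R = ip (\<lambda>x. 0) R"
    proof (rule ip_cong)
      show "ae_eq (\<lambda>x. v x - a * weak_deriv 2 u x) (\<lambda>x. 0)"
        using u2 unfolding ae_eq_def by eventually_elim (simp add: v_def)
    qed (simp_all add: RS L2_diff L2_scale L2_const)
    moreover have "ip (\<lambda>x. \<epsilon> powr (5/2) * weak_deriv 2 v x + 4 * u x) S = ip f S"
    proof (rule ip_cong)
      show "ae_eq (\<lambda>x. \<epsilon> powr (5/2) * weak_deriv 2 v x + 4 * u x) f"
        using v2 unfolding ae_eq_def
      proof eventually_elim
        case (elim x)
        have "\<epsilon> powr (5/2) * weak_deriv 2 v x = \<epsilon> powr (5/2) * (a * (\<kappa> ^ 4 * (f x - 4 * u x)))"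
          by (simp add: elim w''_def algebra_simps)
        then show ?case unfolding c by simp
      qed
    qed (simp_all add: RS L2_add L2_scale)
    ultimately show ?thesis
      by (simp add: p_eq bform_def rhs_def flip: a_def R_def S_def)
  qed
  with V show ?thesis by (rule that)
qed

theorem proposition2:
  fixes \<epsilon> lam :: real and f :: "real \<Rightarrow> real"
  assumes "0 < \<epsilon>" and "\<epsilon> \<le> 1" and "f \<in> L2" and "3 \<le> lam"
  shows "\<exists>u v. (u, v) \<in> V \<and> (\<forall>p\<in>V. bform \<epsilon> lam (u, v) p = rhs \<epsilon> f p) \<and>
    (\<forall>u' v'. (u', v') \<in> V \<and> (\<forall>p\<in>V. bform \<epsilon> lam (u', v') p = rhs \<epsilon> f p)
      \<longrightarrow> ae_eq u' u \<and> ae_eq v' v)"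
proof -
  obtain u v where uv: "(u, v) \<in> V" "\<And>p. p \<in> V \<Longrightarrow> bform \<epsilon> lam (u, v) p = rhs \<epsilon> f p"
    using solution_exists[OF assms(1,3)] by metis
  have "ae_eq u' u \<and> ae_eq v' v"
    if uv': "(u', v') \<in> V" "\<forall>p\<in>V. bform \<epsilon> lam (u', v') p = rhs \<epsilon> f p" for u' v'
  proof -
    let ?p = "(\<lambda>x. u' x - u x, \<lambda>x. v' x - v x)"
    have p: "?p \<in> V"
      using uv(1) uv'(1) by (simp add: V_def H2_0_diff sobolev_diff)
    then have "bform \<epsilon> lam ?p ?p = 0"
      using uv uv' by (simp add: bform_diff)
    from bform_definite[OF assms(1,2,4) p this] show ?thesis
      by (simp add: ae_eq_def)
  qed
  with uv show ?thesis by blast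
qed

end
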